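(* For any $\alpha\in(1,2)$ there exist two entire functions $F$ and $G$ such that $G\in\mathcal F$, $GF\in\mathcal F$, and for every entire function $h$ of order at most $\alpha$ we have $hF\in\mathcal F$, but $$GF\notin \overline{\operatorname{Span}}\{pF:\ p\in\mathcal P\}=\overline{\operatorname{Span}}\{e_\lambda F:\ \lambda\in\mathbb C\}.$$
   Context: $\mathcal F$ is the Bargmann--Segal--Fock space of entire functions $F$ with $\|F\|^2_{\mathcal F}=\frac1\pi\int_{\mathbb C}|F(z)|^2e^{-\pi|z|^2}\,dm(z)<\infty$, where $m$ is area Lebesgue measure on $\mathbb C$. $\mathcal P$ is the space of polynomials in $z$ with complex coefficients, $e_\lambda(z)=e^{\lambda z}$, and $\overline{\operatorname{Span}}$ denotes the closure in $\mathcal F$ of the linear span. "Order" is the usual order of an entire function. *)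

theory Defs
  imports
    "HOL-Complex_Analysis.Complex_Analysis"
    "HOL-Computational_Algebra.Polynomial"
    "HOL-Library.Function_Algebras"
begin

definition entire :: "(complex \<Rightarrow> complex) \<Rightarrow> bool" where
  "entire F \<longleftrightarrow> F holomorphic_on UNIV"

definition max_modulus :: "(complex \<Rightarrow> complex) \<Rightarrow> real \<Rightarrow> real" where
  "max_modulus F r = (SUP z\<in>sphere 0 r. cmod (F z))"

definition ln_plus :: "real \<Rightarrow> real" where
  "ln_plus x = ln (max 1 x)"

(* The usual limsup of log log M(r) / log r. Positive parts of the logarithms only
   matter when F is constant, where they make the order 0 (also for F = 0). *)
definition entire_order :: "(complex \<Rightarrow> complex) \<Rightarrow> ereal" where
  "entire_order F = Limsup at_top (\<lambda>r::real. ereal (ln_plus (ln_plus (max_modulus F r)) / ln r))"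

(* The integrand is nonnegative and continuous for entire F, so integrability
   with respect to area measure is finiteness of the integral. *)
definition fock_space :: "(complex \<Rightarrow> complex) set" where
  "fock_space = {F. entire F \<and> integrable lborel (\<lambda>z. (cmod (F z))\<^sup>2 * exp (- pi * (cmod z)\<^sup>2))}"

(* Only meaningful on fock_space: the Bochner integral of a non-integrable function is 0. *)
definition fock_norm :: "(complex \<Rightarrow> complex) \<Rightarrow> real" where
  "fock_norm F = sqrt (1 / pi * (LINT z|lborel. (cmod (F z))\<^sup>2 * exp (- pi * (cmod z)\<^sup>2)))"

(* Closure of S \<inter> fock_space in the metric of fock_norm. *)
definition fock_closure :: "(complex \<Rightarrow> complex) set \<Rightarrow> (complex \<Rightarrow> complex) set" where
  "fock_closure S = {f \<in> fock_space. \<forall>\<epsilon>>0. \<exists>g \<in> S \<inter> fock_space. fock_norm (\<lambda>z. f z - g z) < \<epsilon>}"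

(* The overloaded span of the library would be the real span; here scalars are complex. *)
definition complex_span :: "(complex \<Rightarrow> complex) set \<Rightarrow> (complex \<Rightarrow> complex) set" where
  "complex_span = module.span (\<lambda>c f z. c * f z)"

lemma vector_space_complex_fun: "vector_space (\<lambda>(c::complex) (f::complex \<Rightarrow> complex) z. c * f z)"
  by unfold_locales (auto simp: fun_eq_iff algebra_simps)

definition closed_span :: "(complex \<Rightarrow> complex) set \<Rightarrow> (complex \<Rightarrow> complex) set" where
  "closed_span S = fock_closure (complex_span S)"

end

theory Submission
  imports Defs "HOL-Real_Asymp.Real_Asymp"
begin

text \<open>
  Fix \<open>\<alpha> < \<beta> < b < 2\<close> and an angle \<open>\<pi>/4 < \<theta> < \<pi>/(2b)\<close>.  The function \<open>F\<close> is a sum of the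
  multiples \<open>k\<^sub>w(z) = exp (\<pi> cnj w z - \<pi>\<bar>w\<bar>\<^sup>2/2)\<close> of reproducing kernels of the Fock space, that is, of Gaussian bumps
  \<open>\<bar>k\<^sub>w(z)\<bar> exp (- \<pi>\<bar>z\<bar>\<^sup>2/2) = exp (- \<pi>\<bar>z - w\<bar>\<^sup>2/2)\<close>, placed at the points
  \<open>w = n exp (\<plusminus>i\<theta>)\<close> of two rays and damped by the factors \<open>exp (- n\<^sup>\<beta>)\<close>.
  The other function is \<open>G(z) = exp (c z\<^sup>2)\<close> with a small \<open>c > 0\<close>.

  Everywhere \<open>\<bar>F(z)\<bar> exp (- \<pi>\<bar>z\<bar>\<^sup>2/2)\<close> is at most a constant times \<open>exp (- \<bar>z\<bar>\<^sup>\<beta>/16)\<close>, which beats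
  every \<open>h\<close> of order at most \<open>\<alpha>\<close>, so \<open>hF\<close> lies in the Fock space; since \<open>\<beta> > 1\<close> it also beats every
  \<open>exp (a\<bar>z\<bar>)\<close>, and by dominated convergence the polynomial and the exponential multiples of \<open>F\<close> have
  the same closed span (\<open>closed_span_polynomials_eq_exps\<close>).  Because \<open>\<theta> > \<pi>/4\<close>, the function \<open>G\<close> is
  bounded on both rays, and away from them its growth is absorbed by the Gaussian decay of the bumps
  (\<open>exp_square_times_two_ray_bound\<close>).

  Convergence in the Fock norm implies uniform convergence relative to \<open>exp (\<pi>\<bar>z\<bar>\<^sup>2/2)\<close>
  (\<open>fock_pointwise_bound\<close>).  On the two rays \<open>\<bar>F\<bar>\<close> is at least a constant times
  \<open>exp (\<pi>r\<^sup>2/2 - r\<^sup>\<beta>)\<close>, so if \<open>pF\<close> is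
  close to \<open>GF\<close>, then \<open>\<bar>p\<bar> \<le> 2 exp (r\<^sup>\<beta>)\<close> there.  The sector between the rays has opening \<open>2\<theta> < \<pi>/b\<close>, and
  the Phragmen-Lindeloef principle for the polynomial \<open>p\<close> (\<open>poly_bound_on_sector\<close>) turns this into
  \<open>\<bar>p(x)\<bar> \<le> K exp (x\<^sup>b)\<close> on the positive half-axis, with \<open>K\<close> independent of \<open>p\<close>.  This bound would be
  inherited by \<open>G\<close> at all positive \<open>x\<close> with \<open>F(x) \<noteq> 0\<close>, whereas \<open>G(x) = exp (c x\<^sup>2)\<close> and \<open>b < 2\<close>.
\<close>

section \<open>The Fock space\<close>

text \<open>
  Summation over discs of integer radius: the exponential factor beats the quadratically growing area.
\<close>

lemma integrable_exp_neg_norm: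
  fixes k :: real assumes "0 < k"
  shows "integrable lborel (\<lambda>z::complex. exp (- k * cmod z))"
proof (rule integrableI_bounded)
  have le: "ennreal (norm (exp (- k * cmod z)))
      \<le> (\<Sum>n. ennreal (exp (- k * real n)) * indicator (cball 0 (real n + 1)) z)" for z
  proof -
    define n where "n = nat \<lfloor>cmod z\<rfloor>"
    have n: "real n \<le> cmod z" "cmod z \<le> real n + 1"
      unfolding n_def using norm_ge_zero[of z] by linarith+
    have "ennreal (norm (exp (- k * cmod z))) \<le> ennreal (exp (- k * real n))"
      using n \<open>0 < k\<close> by (intro ennreal_leI) (simp add: mult_left_mono)
    also have "\<dots> = (\<Sum>m\<in>{n}. ennreal (exp (- k * real m)) * indicator (cball 0 (real m + 1)) z)"
      using n by simp
    also have "\<dots> \<le> (\<Sum>n. ennreal (exp (- k * real n)) * indicator (cball 0 (real n + 1)) z)"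
      by (rule sum_le_suminf) auto
    finally show ?thesis .
  qed
  have "(\<integral>\<^sup>+z. ennreal (norm (exp (- k * cmod z))) \<partial>lborel)
      \<le> (\<integral>\<^sup>+z. (\<Sum>n. ennreal (exp (- k * real n)) * indicator (cball (0::complex) (real n + 1)) z) \<partial>lborel)"
    using le by (intro nn_integral_mono) auto
  also have "\<dots> = (\<Sum>n. ennreal (exp (- k * real n)) * emeasure lborel (cball (0::complex) (real n + 1)))"
    by (subst nn_integral_suminf) (auto intro!: borel_measurable_times_ennreal borel_measurable_indicator simp: nn_integral_cmult_indicator)
  also have "\<dots> = (\<Sum>n. ennreal (pi * ((exp (- k)) ^ n * (real n + 1)\<^sup>2)))"
  proof -
    have "ennreal (exp (- k * real n)) * emeasure lborel (cball (0::complex) (real n + 1))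
        = ennreal (pi * ((exp (- k)) ^ n * (real n + 1)\<^sup>2))" for n
      by (subst emeasure_cball) (auto simp: ennreal_mult'[symmetric] unit_ball_vol_2 exp_of_nat_mult[symmetric] mult_ac)
    then show ?thesis by simp
  qed
  also have "\<dots> < \<infinity>"
  proof -
    have "summable (\<lambda>n. (exp (- k)) ^ n * (real n + 1)\<^sup>2)"
    proof (rule summable_comparison_test_ev)
      have "eventually (\<lambda>n. (real n + 1)\<^sup>2 * exp (- k * real n) \<le> exp (- (k/2) * real n)) at_top"
        using \<open>0 < k\<close> by real_asymp
      then show "\<forall>\<^sub>F n in sequentially. norm ((exp (- k)) ^ n * (real n + 1)\<^sup>2) \<le> exp (- (k/2)) ^ n"
        by (simp add: exp_of_nat_mult[symmetric] mult_ac)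
      show "summable (\<lambda>n. exp (- (k/2)) ^ n)"
        using \<open>0 < k\<close> by (intro summable_geometric) auto
    qed
    then have "summable (\<lambda>n. pi * ((exp (- k)) ^ n * (real n + 1)\<^sup>2))"
      by (rule summable_mult)
    then show ?thesis
      by (subst suminf_ennreal2) (auto intro!: mult_nonneg_nonneg)
  qed
  finally show "(\<integral>\<^sup>+z. ennreal (norm (exp (- k * cmod z))) \<partial>(lborel::complex measure)) < \<infinity>" .
qed auto

lemma entire_borel_measurable: "entire f \<Longrightarrow> f \<in> borel_measurable borel"
  unfolding entire_def
  by (intro borel_measurable_continuous_onI holomorphic_on_imp_continuous_on)

lemma fock_integrand_measurable:
  "entire f \<Longrightarrow> (\<lambda>z. (cmod (f z))\<^sup>2 * exp (- pi * (cmod z)\<^sup>2)) \<in> borel_measurable lborel"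
  using entire_borel_measurable[of f] by measurable

text \<open>
  All membership proofs go through this pointwise criterion: any exponential gain over the critical
  growth \<open>exp (\<pi>\<bar>z\<bar>\<^sup>2/2)\<close> makes the integrand decay exponentially.
\<close>

lemma fock_spaceI_bound:
  assumes "entire f" and "0 < k"
    and bound: "\<And>z. cmod (f z) \<le> C * exp (pi * (cmod z)\<^sup>2 / 2 - k * cmod z)"
  shows "f \<in> fock_space"
proof -
  have "integrable lborel (\<lambda>z. (cmod (f z))\<^sup>2 * exp (- pi * (cmod z)\<^sup>2))"
  proof (rule Bochner_Integration.integrable_bound)
    show "integrable lborel (\<lambda>z. C\<^sup>2 * exp (- (2 * k) * cmod z))"
      using integrable_exp_neg_norm[of "2 * k"] \<open>0 < k\<close> by (intro integrable_mult_right) auto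
    have "norm ((cmod (f z))\<^sup>2 * exp (- pi * (cmod z)\<^sup>2)) \<le> norm (C\<^sup>2 * exp (- (2 * k) * cmod z))" for z
    proof -
      have "(cmod (f z))\<^sup>2 * exp (- pi * (cmod z)\<^sup>2)
          \<le> (C * exp (pi * (cmod z)\<^sup>2 / 2 - k * cmod z))\<^sup>2 * exp (- pi * (cmod z)\<^sup>2)"
        by (intro mult_right_mono power_mono bound) auto
      also have "\<dots> = C\<^sup>2 * exp (- (2 * k) * cmod z)"
        by (simp add: power_mult_distrib exp_double[symmetric] exp_add[symmetric] algebra_simps)
      finally show ?thesis by simp
    qed
    then show "AE z in lborel. norm ((cmod (f z))\<^sup>2 * exp (- pi * (cmod z)\<^sup>2))
        \<le> norm (C\<^sup>2 * exp (- (2 * k) * cmod z))" by simp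
  qed (use fock_integrand_measurable[OF \<open>entire f\<close>] in simp)
  then show ?thesis using \<open>entire f\<close> by (simp add: fock_space_def)
qed

lemma fock_norm_nonneg [simp]: "0 \<le> fock_norm f"
  unfolding fock_norm_def by (intro real_sqrt_ge_zero mult_nonneg_nonneg integral_nonneg_AE) auto

lemma fock_norm_squared:
  "(fock_norm f)\<^sup>2 = (LINT z|lborel. (cmod (f z))\<^sup>2 * exp (- pi * (cmod z)\<^sup>2)) / pi"
  unfolding fock_norm_def by (subst real_sqrt_pow2) (auto intro!: mult_nonneg_nonneg integral_nonneg_AE)

lemma fock_space_entire: "f \<in> fock_space \<Longrightarrow> entire f"
  and fock_space_integrable:
    "f \<in> fock_space \<Longrightarrow> integrable lborel (\<lambda>z. (cmod (f z))\<^sup>2 * exp (- pi * (cmod z)\<^sup>2))"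
  by (auto simp: fock_space_def)

text \<open>
  This pointwise inequality replaces the triangle inequality of the norm: it bounds the norm of a sum
  up to a factor, which is enough for statements about closures.
\<close>

lemma norm_add_squared_le: "(cmod (a + b))\<^sup>2 \<le> 2 * (cmod a)\<^sup>2 + 2 * (cmod b)\<^sup>2"
proof -
  have "(cmod (a + b))\<^sup>2 \<le> (cmod a + cmod b)\<^sup>2"
    by (intro power_mono norm_triangle_ineq) auto
  also have "\<dots> \<le> 2 * (cmod a)\<^sup>2 + 2 * (cmod b)\<^sup>2"
    using sum_squares_ge_zero[of "cmod a - cmod b" 0] by (simp add: power2_eq_square algebra_simps)
  finally show ?thesis .
qed

lemma fock_space_add:
  assumes "f \<in> fock_space" "g \<in> fock_space"
  shows "(\<lambda>z. f z + g z) \<in> fock_space"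
    and "(fock_norm (\<lambda>z. f z + g z))\<^sup>2 \<le> 2 * (fock_norm f)\<^sup>2 + 2 * (fock_norm g)\<^sup>2"
proof -
  let ?w = "\<lambda>z. exp (- pi * (cmod z)\<^sup>2)"
  let ?B = "\<lambda>z. 2 * ((cmod (f z))\<^sup>2 * ?w z) + 2 * ((cmod (g z))\<^sup>2 * ?w z)"
  note int = assms[THEN fock_space_integrable]
  have ent: "entire (\<lambda>z. f z + g z)"
    using assms[THEN fock_space_entire] by (auto simp: entire_def intro: holomorphic_intros)
  have B: "integrable lborel ?B"
    by (intro Bochner_Integration.integrable_add integrable_mult_right int)
  have le: "(cmod (f z + g z))\<^sup>2 * ?w z \<le> ?B z" for z
    using mult_right_mono[OF norm_add_squared_le[of "f z" "g z"], of "?w z"]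
    by (simp add: algebra_simps)
  have "integrable lborel (\<lambda>z. (cmod (f z + g z))\<^sup>2 * ?w z)"
  proof (rule Bochner_Integration.integrable_bound[OF B])
    show "AE z in lborel. norm ((cmod (f z + g z))\<^sup>2 * ?w z) \<le> norm (?B z)"
      using le by (auto intro!: AE_I2)
  qed (use fock_integrand_measurable[OF ent] in simp)
  then show *: "(\<lambda>z. f z + g z) \<in> fock_space"
    using ent by (simp add: fock_space_def)
  have "(LINT z|lborel. (cmod (f z + g z))\<^sup>2 * ?w z) \<le> (LINT z|lborel. ?B z)"
    using fock_space_integrable[OF *] B le by (intro integral_mono) auto
  also have "\<dots> = 2 * (LINT z|lborel. (cmod (f z))\<^sup>2 * ?w z) + 2 * (LINT z|lborel. (cmod (g z))\<^sup>2 * ?w z)"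
    using int by simp
  finally show "(fock_norm (\<lambda>z. f z + g z))\<^sup>2 \<le> 2 * (fock_norm f)\<^sup>2 + 2 * (fock_norm g)\<^sup>2"
    unfolding fock_norm_squared by (simp add: field_simps)
qed

lemma fock_space_cmult:
  assumes "f \<in> fock_space"
  shows "(\<lambda>z. c * f z) \<in> fock_space" and "fock_norm (\<lambda>z. c * f z) = cmod c * fock_norm f"
proof -
  have eq: "(\<lambda>z. (cmod (c * f z))\<^sup>2 * exp (- pi * (cmod z)\<^sup>2))
      = (\<lambda>z. (cmod c)\<^sup>2 * ((cmod (f z))\<^sup>2 * exp (- pi * (cmod z)\<^sup>2)))"
    by (simp add: norm_mult power_mult_distrib mult_ac)
  show "(\<lambda>z. c * f z) \<in> fock_space"
    using assms unfolding fock_space_def mem_Collect_eq eq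
    by (auto simp: entire_def intro: holomorphic_intros)
  show "fock_norm (\<lambda>z. c * f z) = cmod c * fock_norm f"
    unfolding fock_norm_def eq by (simp add: real_sqrt_mult real_sqrt_divide)
qed

lemma fock_space_diff:
  assumes "f \<in> fock_space" "g \<in> fock_space"
  shows "(\<lambda>z. f z - g z) \<in> fock_space"
  using fock_space_add(1)[OF assms(1) fock_space_cmult(1)[OF assms(2), of "-1"]] by simp

lemma fock_norm_add_less:
  assumes "f \<in> fock_space" "g \<in> fock_space" "fock_norm f < \<epsilon> / 2" "fock_norm g < \<epsilon> / 2"
  shows "fock_norm (\<lambda>z. f z + g z) < \<epsilon>"
proof -
  have "0 < \<epsilon>" using assms(3) fock_norm_nonneg[of f] by linarith
  have "(fock_norm f)\<^sup>2 < (\<epsilon> / 2)\<^sup>2" "(fock_norm g)\<^sup>2 < (\<epsilon> / 2)\<^sup>2"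
    using assms by (auto intro!: power_strict_mono)
  then have "(fock_norm (\<lambda>z. f z + g z))\<^sup>2 < \<epsilon>\<^sup>2"
    using fock_space_add(2)[OF assms(1,2)] by (simp add: power2_eq_square)
  then show ?thesis
    using \<open>0 < \<epsilon>\<close> by (rule power2_less_imp_less[OF _ less_imp_le])
qed

interpretation cfun: vector_space "\<lambda>(c::complex) (f::complex \<Rightarrow> complex) z. c * f z"
  by (rule vector_space_complex_fun)

lemma complex_span_mem: "f \<in> S \<Longrightarrow> f \<in> complex_span S"
  unfolding complex_span_def by (rule cfun.span_base)

lemma complex_span_diff: "f \<in> complex_span S \<Longrightarrow> g \<in> complex_span S \<Longrightarrow> (\<lambda>z. f z - g z) \<in> complex_span S"
  unfolding complex_span_def using cfun.span_diff[of f S g] by (simp add: fun_diff_def)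

lemma complex_span_add: "f \<in> complex_span S \<Longrightarrow> g \<in> complex_span S \<Longrightarrow> (\<lambda>z. f z + g z) \<in> complex_span S"
  unfolding complex_span_def using cfun.span_add[of f S g] by (simp add: plus_fun_def)

lemma complex_span_cmult: "f \<in> complex_span S \<Longrightarrow> (\<lambda>z. c * f z) \<in> complex_span S"
  unfolding complex_span_def using cfun.span_scale[of f S c] by simp

lemma complex_span_subset:
  assumes "S \<subseteq> V" "(\<lambda>z. 0) \<in> V"
    and "\<And>f g. f \<in> V \<Longrightarrow> g \<in> V \<Longrightarrow> (\<lambda>z. f z + g z) \<in> V"
    and "\<And>c f. f \<in> V \<Longrightarrow> (\<lambda>z. c * f z) \<in> V"
  shows "complex_span S \<subseteq> V"
  unfolding complex_span_def
proof (rule cfun.span_minimal[OF \<open>S \<subseteq> V\<close>])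
  show "module.subspace (\<lambda>(c::complex) (f::complex \<Rightarrow> complex) z. c * f z) V"
    using assms(2-4) by (auto simp: cfun.subspace_def zero_fun_def plus_fun_def)
qed

lemma fock_zero: "(\<lambda>z. 0) \<in> fock_space" "fock_norm (\<lambda>z. 0) = 0"
  by (auto simp: fock_space_def entire_def fock_norm_def)

lemma closed_spanI:
  assumes "f \<in> fock_space"
    and "\<And>\<epsilon>. 0 < \<epsilon> \<Longrightarrow> \<exists>g. g \<in> complex_span S \<and> g \<in> fock_space \<and> fock_norm (\<lambda>z. f z - g z) < \<epsilon>"
  shows "f \<in> closed_span S"
  using assms unfolding closed_span_def fock_closure_def by blast

lemma closed_spanD:
  assumes "f \<in> closed_span S"
  shows "f \<in> fock_space"
    and "0 < \<epsilon> \<Longrightarrow> \<exists>g. g \<in> complex_span S \<and> g \<in> fock_space \<and> fock_norm (\<lambda>z. f z - g z) < \<epsilon>"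
  using assms unfolding closed_span_def fock_closure_def by auto

lemma closed_span_add:
  assumes "f \<in> closed_span S" "g \<in> closed_span S"
  shows "(\<lambda>z. f z + g z) \<in> closed_span S"
proof (rule closed_spanI)
  note fock = assms[THEN closed_spanD(1)]
  show "(\<lambda>z. f z + g z) \<in> fock_space" by (rule fock_space_add(1)[OF fock])
  fix \<epsilon> :: real assume "0 < \<epsilon>"
  then have "0 < \<epsilon> / 2" by simp
  obtain f' g' where *: "f' \<in> complex_span S" "f' \<in> fock_space" "fock_norm (\<lambda>z. f z - f' z) < \<epsilon> / 2"
      "g' \<in> complex_span S" "g' \<in> fock_space" "fock_norm (\<lambda>z. g z - g' z) < \<epsilon> / 2"
    using assms[THEN closed_spanD(2), OF \<open>0 < \<epsilon> / 2\<close>] by blast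
  have "fock_norm (\<lambda>z. (f z - f' z) + (g z - g' z)) < \<epsilon>"
    using * fock by (intro fock_norm_add_less fock_space_diff)
  moreover have "(\<lambda>z. (f z - f' z) + (g z - g' z)) = (\<lambda>z. (f z + g z) - (f' z + g' z))"
    by (simp add: algebra_simps)
  ultimately show "\<exists>h. h \<in> complex_span S \<and> h \<in> fock_space \<and> fock_norm (\<lambda>z. f z + g z - h z) < \<epsilon>"
    using * by (intro exI[of _ "\<lambda>z. f' z + g' z"]) (auto intro: complex_span_add fock_space_add(1))
qed

lemma closed_span_cmult:
  assumes "f \<in> closed_span S"
  shows "(\<lambda>z. c * f z) \<in> closed_span S"
proof (rule closed_spanI)
  note fock = assms[THEN closed_spanD(1)]
  show "(\<lambda>z. c * f z) \<in> fock_space" by (rule fock_space_cmult(1)[OF fock])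
  fix \<epsilon> :: real assume "0 < \<epsilon>"
  then have "0 < \<epsilon> / (cmod c + 1)" by (simp add: add_nonneg_pos)
  then obtain f' where *: "f' \<in> complex_span S" "f' \<in> fock_space"
      "fock_norm (\<lambda>z. f z - f' z) < \<epsilon> / (cmod c + 1)"
    using closed_spanD(2)[OF assms] by blast
  have "fock_norm (\<lambda>z. c * (f z - f' z)) = cmod c * fock_norm (\<lambda>z. f z - f' z)"
    using * fock by (intro fock_space_cmult fock_space_diff)
  also have "\<dots> \<le> cmod c * (\<epsilon> / (cmod c + 1))"
    using * by (intro mult_left_mono) auto
  also have "\<dots> < \<epsilon>"
    using \<open>0 < \<epsilon>\<close> norm_ge_zero[of c] by (subst times_divide_eq_right, subst pos_divide_less_eq) (auto simp: algebra_simps add_pos_nonneg)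
  finally have "fock_norm (\<lambda>z. c * f z - c * f' z) < \<epsilon>"
    by (simp add: algebra_simps)
  then show "\<exists>h. h \<in> complex_span S \<and> h \<in> fock_space \<and> fock_norm (\<lambda>z. c * f z - h z) < \<epsilon>"
    using * by (intro exI[of _ "\<lambda>z. c * f' z"]) (auto intro: complex_span_cmult fock_space_cmult(1))
qed

text \<open>
  The closed span of \<open>T\<close> is itself a closed subspace; a set of generators is therefore all that has to
  be approximated.
\<close>

lemma closed_span_subset:
  assumes "S \<subseteq> closed_span T"
  shows "closed_span S \<subseteq> closed_span T"
proof
  have "complex_span S \<subseteq> closed_span T"
  proof (rule complex_span_subset[OF assms])
    have "(\<lambda>z. 0) \<in> complex_span T"
      unfolding complex_span_def using cfun.span_zero[of T] by (simp add: zero_fun_def)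
    then show "(\<lambda>z. 0) \<in> closed_span T"
      by (intro closed_spanI) (auto simp: fock_zero intro!: exI[of _ "\<lambda>z. 0"])
  qed (auto intro: closed_span_add closed_span_cmult)
  fix f assume f: "f \<in> closed_span S"
  show "f \<in> closed_span T"
  proof (rule closed_spanI)
    show fock: "f \<in> fock_space" by (rule closed_spanD(1)[OF f])
    fix \<epsilon> :: real assume "0 < \<epsilon>"
    then have "0 < \<epsilon> / 2" by simp
    obtain g where g: "g \<in> complex_span S" "g \<in> fock_space" "fock_norm (\<lambda>z. f z - g z) < \<epsilon> / 2"
      using closed_spanD(2)[OF f \<open>0 < \<epsilon> / 2\<close>] by blast
    then have "g \<in> closed_span T" using \<open>complex_span S \<subseteq> closed_span T\<close> by auto
    then obtain h where h: "h \<in> complex_span T" "h \<in> fock_space" "fock_norm (\<lambda>z. g z - h z) < \<epsilon> / 2"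
      using closed_spanD(2)[OF _ \<open>0 < \<epsilon> / 2\<close>] by blast
    have "fock_norm (\<lambda>z. (f z - g z) + (g z - h z)) < \<epsilon>"
      using g h fock by (intro fock_norm_add_less fock_space_diff)
    then show "\<exists>h. h \<in> complex_span T \<and> h \<in> fock_space \<and> fock_norm (\<lambda>z. f z - h z) < \<epsilon>"
      using h by auto
  qed
qed


section \<open>Point evaluations\<close>

text \<open>
  Transports area integrals to the plane \<open>\<real> \<times> \<real>\<close>, where Fubini's theorem is applied.
\<close>

lemma lborel_complex_eq_distr:
  "(lborel :: complex measure) = distr (lborel :: (real \<times> real) measure) borel (\<lambda>p. Complex (fst p) (snd p))"
proof (rule lborel_eqI)
  have meas: "(\<lambda>p. Complex (fst p) (snd p)) \<in> borel_measurable borel"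
    by (intro borel_measurable_continuous_onI) (auto simp: Complex_eq intro!: continuous_intros)
  fix l u :: complex assume lu: "\<And>b. b \<in> Basis \<Longrightarrow> l \<bullet> b \<le> u \<bullet> b"
  have le: "Re l \<le> Re u" "Im l \<le> Im u" using lu[of 1] lu[of \<i>] by (auto simp: Basis_complex_def)
  have "emeasure (distr (lborel :: (real \<times> real) measure) borel (\<lambda>p. Complex (fst p) (snd p))) (box l u)
      = emeasure (lborel :: (real \<times> real) measure) (box (Re l, Im l) (Re u, Im u))"
    using meas by (subst emeasure_distr)
      (auto intro!: arg_cong[where f = "emeasure lborel"] simp: in_box_complex_iff mem_box Basis_prod_def)
  also have "\<dots> = ennreal (\<Prod>b\<in>Basis. (u - l) \<bullet> b)"
  proof -
    have "emeasure (lborel :: (real \<times> real) measure) (box (Re l, Im l) (Re u, Im u))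
        = ennreal (\<Prod>b\<in>Basis. ((Re u, Im u) - (Re l, Im l)) \<bullet> b)"
      using le by (intro emeasure_lborel_box) (auto simp: Basis_prod_def)
    also have "(\<Prod>b\<in>Basis. ((Re u, Im u) - (Re l, Im l)) \<bullet> b) = (\<Prod>b\<in>Basis. (u - l) \<bullet> b)"
      by (simp add: Basis_complex_def Basis_prod_def)
    finally show ?thesis .
  qed
  finally show "emeasure (distr (lborel :: (real \<times> real) measure) borel (\<lambda>p. Complex (fst p) (snd p))) (box l u)
      = ennreal (\<Prod>b\<in>Basis. (u - l) \<bullet> b)" .
qed simp

lemma contour_integral_linepath_same_Im:
  assumes "a < b"
  shows "contour_integral (linepath (Complex a c) (Complex b c)) f = integral {a..b} (\<lambda>x. f (Complex x c))"
proof -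
  have "contour_integral (linepath (Complex a c) (Complex b c)) f
      = (Complex b c - Complex a c) * integral {0..1} (\<lambda>x. f (linepath (Complex a c) (Complex b c) x))"
    by (simp add: contour_integral_integral)
  also have "Complex b c - Complex a c = of_real (b - a)"
    by (simp add: complex_eq_iff)
  also have "integral {0..1} (\<lambda>x. f (linepath (Complex a c) (Complex b c) x)) =
      integral {0..(b - a) / (b - a)} (\<lambda>x. f (Complex (a + (b - a) * x) c))"
    using \<open>a < b\<close> by (simp add: linepath_def Complex_eq scaleR_conv_of_real algebra_simps)
  also have "{0..(b - a) / (b - a)} = (\<lambda>x. x / (b - a)) ` {0..b - a}"
    using \<open>a < b\<close> by simp
  also have "integral \<dots> (\<lambda>x. f (Complex (a + (b - a) * x) c)) =
      integral {a-a..b-a} (\<lambda>x. f (Complex (x + a) c)) / of_real (b - a)"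
    using \<open>a < b\<close> by (subst integral_stretch_real) (auto simp: scaleR_conv_of_real add_ac)
  also have "\<dots> = integral {a..b} (\<lambda>x. f (Complex x c)) / of_real (b - a)"
    by (subst integral_shift_real_ivl) (rule refl)
  finally show ?thesis
    using \<open>a < b\<close> by simp
qed

text \<open>
  Cauchy's integral formula over the boundary of the square with half-side \<open>s\<close>, where \<open>\<bar>w\<bar> \<ge> s \<ge> 1\<close>.
  The four sides are enlarged to length \<open>4\<close>, so that the range of integration no longer depends on \<open>s\<close>.
\<close>

lemma square_boundary_estimate:
  fixes f :: "complex \<Rightarrow> complex" and s :: real
  assumes "f holomorphic_on UNIV" "1 \<le> s" "s \<le> 2"
  shows "2 * pi * cmod (f 0) \<le>
      integral {-2..2} (\<lambda>y. cmod (f (Complex s y))) + integral {-2..2} (\<lambda>y. cmod (f (Complex (- s) y)))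
    + integral {-2..2} (\<lambda>x. cmod (f (Complex x s))) + integral {-2..2} (\<lambda>x. cmod (f (Complex x (- s))))"
proof -
  let ?g = "\<lambda>w. f w / w"
  let ?a = "Complex (- s) (- s)" and ?b = "Complex s (- s)" and ?c = "Complex s s" and ?d = "Complex (- s) s"
  have cf: "continuous_on A (\<lambda>t. f (h t))" if "continuous_on A h" for A :: "real set" and h
    using holomorphic_on_imp_continuous_on[OF assms(1)] that by (rule continuous_on_compose2) auto
  have cC: "continuous_on A (\<lambda>t. Complex (p t) (q t))" if "continuous_on A p" "continuous_on A q" for A :: "real set" and p q
    using that unfolding Complex_eq by (intro continuous_intros)
  have seg: "cmod (contour_integral (linepath a b) ?g) \<le> I"
    if eq: "contour_integral (linepath a b) ?g = c * integral {-s..s} (\<lambda>t. ?g (Complex (p t) (q t)))"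
      and c: "cmod c = 1"
      and pq: "continuous_on UNIV p" "continuous_on UNIV q" "\<And>t. \<bar>p t\<bar> = s \<or> \<bar>q t\<bar> = s"
      and I: "I = integral {-2..2} (\<lambda>t. cmod (f (Complex (p t) (q t))))" for a b c p q I
  proof -
    have far: "1 \<le> cmod (Complex (p t) (q t))" for t
      using pq(3)[of t] abs_Re_le_cmod[of "Complex (p t) (q t)"] abs_Im_le_cmod[of "Complex (p t) (q t)"] \<open>1 \<le> s\<close>
      by auto
    have pq': "continuous_on A p" "continuous_on A q" for A using pq continuous_on_subset by blast+
    have ci: "continuous_on A (\<lambda>t. f (Complex (p t) (q t)))" for A
      by (intro cf cC pq')
    have "cmod (contour_integral (linepath a b) ?g) = cmod (integral {-s..s} (\<lambda>t. ?g (Complex (p t) (q t))))"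
      by (simp add: eq c norm_mult)
    also have "\<dots> \<le> integral {-s..s} (\<lambda>t. cmod (f (Complex (p t) (q t))))"
    proof (rule integral_norm_bound_integral)
      have "Complex (p t) (q t) \<noteq> 0" for t using far[of t] by auto
      then show "(\<lambda>t. ?g (Complex (p t) (q t))) integrable_on {-s..s}"
        by (intro integrable_continuous_interval continuous_intros ci cC pq') auto
      show "(\<lambda>t. cmod (f (Complex (p t) (q t)))) integrable_on {-s..s}"
        by (intro integrable_continuous_interval continuous_intros ci)
      show "cmod (?g (Complex (p t) (q t))) \<le> cmod (f (Complex (p t) (q t)))" if "t \<in> {-s..s}" for t
      proof -
        have "cmod (f (Complex (p t) (q t))) / cmod (Complex (p t) (q t)) \<le> cmod (f (Complex (p t) (q t))) / 1"
          using far[of t] by (intro divide_left_mono) auto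
        then show ?thesis by (simp add: norm_divide)
      qed
    qed
    also have "\<dots> \<le> I" unfolding I
      using \<open>s \<le> 2\<close> by (intro integral_subset_le integrable_continuous_interval continuous_intros ci) auto
    finally show ?thesis .
  qed
  have box: "(0::complex) \<in> box ?a ?c" using \<open>1 \<le> s\<close> by (simp add: in_box_complex_iff)
  have img: "0 \<notin> path_image (rectpath ?a ?c)"
    using box path_image_rectpath_inter_box[of ?a ?c] \<open>1 \<le> s\<close> by auto
  have "((\<lambda>w. f w / (w - 0)) has_contour_integral (2 * pi * \<i> * winding_number (rectpath ?a ?c) 0 * f 0)) (rectpath ?a ?c)"
    by (rule Cauchy_integral_formula_convex_simple[OF convex_UNIV assms(1)]) (use img in auto)
  then have cauchy: "(?g has_contour_integral (2 * pi * \<i> * f 0)) (rectpath ?a ?c)"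
    using winding_number_rectpath[OF box] by simp
  have gi: "?g contour_integrable_on linepath x y" if "0 \<notin> closed_segment x y" for x y
    using that holomorphic_on_imp_continuous_on[OF assms(1)]
    by (intro contour_integrable_continuous_linepath continuous_intros)
      (auto intro: continuous_on_subset)
  have segs: "0 \<notin> closed_segment ?a ?b" "0 \<notin> closed_segment ?b ?c" "0 \<notin> closed_segment ?c ?d" "0 \<notin> closed_segment ?d ?a"
  proof -
    have "path_image (rectpath ?a ?c) = closed_segment ?a ?b \<union> closed_segment ?b ?c \<union> closed_segment ?c ?d \<union> closed_segment ?d ?a"
      by (simp add: rectpath_def Let_def path_image_join Un_ac)
    with img show "0 \<notin> closed_segment ?a ?b" "0 \<notin> closed_segment ?b ?c" "0 \<notin> closed_segment ?c ?d" "0 \<notin> closed_segment ?d ?a"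
      by auto
  qed
  have "2 * pi * \<i> * f 0 = contour_integral (rectpath ?a ?c) ?g"
    using cauchy by (simp add: contour_integral_unique)
  also have "\<dots> = contour_integral (linepath ?a ?b) ?g + (contour_integral (linepath ?b ?c) ?g
      + (contour_integral (linepath ?c ?d) ?g + contour_integral (linepath ?d ?a) ?g))"
    unfolding rectpath_def Let_def
    by (simp add: gi segs)
  finally have eq: "2 * pi * \<i> * f 0 = contour_integral (linepath ?a ?b) ?g + (contour_integral (linepath ?b ?c) ?g
      + (contour_integral (linepath ?c ?d) ?g + contour_integral (linepath ?d ?a) ?g))" .
  have "cmod (2 * pi * \<i> * f 0) \<le> cmod (contour_integral (linepath ?a ?b) ?g) + (cmod (contour_integral (linepath ?b ?c) ?g)
      + (cmod (contour_integral (linepath ?c ?d) ?g) + cmod (contour_integral (linepath ?d ?a) ?g)))"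
    unfolding eq by (intro order_trans[OF norm_triangle_ineq] add_left_mono order_refl)
  moreover have "cmod (contour_integral (linepath ?a ?b) ?g) \<le> integral {-2..2} (\<lambda>x. cmod (f (Complex x (- s))))"
    by (rule seg[of _ _ 1 "\<lambda>t. t" "\<lambda>t. - s"])
      (use \<open>1 \<le> s\<close> in \<open>auto simp: contour_integral_linepath_same_Im[of "- s" s]\<close>)
  moreover have "cmod (contour_integral (linepath ?b ?c) ?g) \<le> integral {-2..2} (\<lambda>y. cmod (f (Complex s y)))"
    by (rule seg[of _ _ \<i> "\<lambda>t. s" "\<lambda>t. t"])
      (use \<open>1 \<le> s\<close> in \<open>auto simp: contour_integral_linepath_same_Re[of _ s _ "- s" s]\<close>)
  moreover have "cmod (contour_integral (linepath ?c ?d) ?g) \<le> integral {-2..2} (\<lambda>x. cmod (f (Complex x s)))"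
  proof (rule seg[of _ _ "-1" "\<lambda>t. t" "\<lambda>t. s"])
    have "contour_integral (linepath ?c ?d) ?g = - contour_integral (linepath ?d ?c) ?g"
      using contour_integral_reversepath[of "linepath ?d ?c" ?g] by simp
    then show "contour_integral (linepath ?c ?d) ?g = -1 * integral {-s..s} (\<lambda>t. ?g (Complex t s))"
      using \<open>1 \<le> s\<close> by (simp add: contour_integral_linepath_same_Im[of "- s" s])
  qed (use \<open>1 \<le> s\<close> in auto)
  moreover have "cmod (contour_integral (linepath ?d ?a) ?g) \<le> integral {-2..2} (\<lambda>y. cmod (f (Complex (- s) y)))"
  proof (rule seg[of _ _ "-\<i>" "\<lambda>t. - s" "\<lambda>t. t"])
    have "contour_integral (linepath ?d ?a) ?g = - contour_integral (linepath ?a ?d) ?g"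
      using contour_integral_reversepath[of "linepath ?a ?d" ?g] by simp
    then show "contour_integral (linepath ?d ?a) ?g = -\<i> * integral {-s..s} (\<lambda>t. ?g (Complex (- s) t))"
      using \<open>1 \<le> s\<close> by (simp add: contour_integral_linepath_same_Re[of _ "- s" _ "- s" s])
  qed (use \<open>1 \<le> s\<close> in auto)
  ultimately show ?thesis by (simp add: norm_mult)
qed

text \<open>
  Averaging the boundary estimate over \<open>s \<in> [1,2]\<close> turns each of the four boundary integrals into an
  area integral over a strip contained in the square \<open>Q\<close>.  The resulting constant \<open>4/(2\<pi>)\<close> is below \<open>1\<close>.
\<close>

lemma norm_at_zero_le_area_integral:
  fixes f :: "complex \<Rightarrow> complex"
  assumes "f holomorphic_on UNIV"
  defines "Q \<equiv> cbox (Complex (-2) (-2)) (Complex 2 2)"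
  shows "cmod (f 0) \<le> (LINT z|lborel. indicator Q z * cmod (f z))"
    and "integrable lborel (\<lambda>z. indicator Q z * cmod (f z))"
proof -
  define u where "u = (\<lambda>p::real\<times>real. cmod (f (Complex (fst p) (snd p))))"
  have cf: "continuous_on UNIV f" by (rule holomorphic_on_imp_continuous_on[OF assms(1)])
  have cC: "continuous_on A (\<lambda>p::real\<times>real. Complex (fst p) (snd p))" for A
    unfolding Complex_eq by (intro continuous_intros)
  have cu: "continuous_on A u" for A
    unfolding u_def by (intro continuous_intros continuous_on_compose2[OF cf] cC) auto
  define I where "I = integral (cbox (-2,-2) (2,2)) u"
  define V where "V = (\<lambda>s. integral (cbox (-2) 2) (\<lambda>y. u (s, y)))"
  define U where "U = (\<lambda>s. integral (cbox (-2) 2) (\<lambda>x. u (x, s)))"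
  have V_int: "integral {-2..2} V = I"
    unfolding I_def V_def using integral_prod_continuous[OF cu, of "-2" "-2" 2 2] by simp
  have U_int: "integral {-2..2} U = I"
    unfolding U_def using integral_swap_continuous[of "-2::real" "-2::real" 2 2 "\<lambda>x y. u (x, y)"] cu V_int
    unfolding V_def by (simp add: case_prod_unfold)
  have cV: "continuous_on A V" for A
    unfolding V_def by (rule integral_continuous_on_param) (auto simp: case_prod_unfold intro: cu)
  have cU: "continuous_on A U" for A
    unfolding U_def
    by (rule integral_continuous_on_param) (auto simp: case_prod_unfold intro!: continuous_on_compose2[OF cu] continuous_intros)
  have V0: "0 \<le> V s" and U0: "0 \<le> U s" for s
  proof -
    have "continuous_on (cbox (-2) 2) (\<lambda>y. u (s, y))" "continuous_on (cbox (-2) 2) (\<lambda>x. u (x, s))"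
      by (auto intro!: continuous_on_compose2[OF cu[of UNIV]] continuous_intros)
    then show "0 \<le> V s" "0 \<le> U s"
      unfolding V_def U_def by (auto intro!: integral_nonneg integrable_continuous_interval simp: u_def)
  qed
  have ii: "W integrable_on {a..b}" if "\<And>A. continuous_on A W" for W :: "real \<Rightarrow> real" and a b
    using that by (intro integrable_continuous_interval)
  have part: "integral {1..2} W \<le> I" "integral {1..2} (\<lambda>s. W (- s)) \<le> I"
    if W: "\<And>A. continuous_on A W" "\<And>s. 0 \<le> W s" "integral {-2..2} W = I" for W :: "real \<Rightarrow> real"
  proof -
    show "integral {1..2} W \<le> I"
      using W unfolding W(3)[symmetric] by (intro integral_subset_le ii) auto
    have "integral {1..2} (\<lambda>s. W (- s)) = integral {-2..-1} W"
      using Henstock_Kurzweil_Integration.integral_reflect_real[where a = "-2" and b = "-1" and f = W] by simp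
    also have "\<dots> \<le> I"
      using W unfolding W(3)[symmetric] by (intro integral_subset_le ii) auto
    finally show "integral {1..2} (\<lambda>s. W (- s)) \<le> I" .
  qed
  have cm: "continuous_on A (\<lambda>s. W (- s))" if "\<And>A. continuous_on A W" for A and W :: "real \<Rightarrow> real"
    by (rule continuous_on_compose2[OF that[of UNIV]]) (auto intro: continuous_on_minus continuous_on_id)
  have "integral {1..2::real} (\<lambda>s. 2 * pi * cmod (f 0))
      \<le> integral {1..2} (\<lambda>s. V s + V (- s) + U s + U (- s))"
  proof (rule integral_le)
    show "(\<lambda>s. V s + V (- s) + U s + U (- s)) integrable_on {1..2}"
      by (intro integrable_add ii cV cU cm)
    show "2 * pi * cmod (f 0) \<le> V s + V (- s) + U s + U (- s)" if "s \<in> {1..2}" for s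
      using square_boundary_estimate[OF assms(1), of s] that by (simp add: V_def U_def u_def)
  qed auto
  also have "\<dots> = integral {1..2} V + integral {1..2} (\<lambda>s. V (- s)) + integral {1..2} U + integral {1..2} (\<lambda>s. U (- s))"
    by (simp add: Henstock_Kurzweil_Integration.integral_add integrable_add ii cV cU cm)
  also have "\<dots> \<le> 4 * I"
    using part[OF cV V0 V_int] part[OF cU U0 U_int] by linarith
  finally have "2 * pi * cmod (f 0) \<le> 4 * I" by simp
  moreover have "4 * cmod (f 0) \<le> 2 * pi * cmod (f 0)"
    using pi_gt3 by (intro mult_right_mono) auto
  ultimately have le: "cmod (f 0) \<le> I" by linarith
  have "set_integrable lborel (cbox (-2,-2) (2,2)) u"
    unfolding set_integrable_def by (intro borel_integrable_compact compact_cbox cu)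
  then have int_u: "integrable lborel (\<lambda>p. indicator (cbox (-2,-2) (2,2)) p * u p)"
    and eq_u: "(LINT p|lborel. indicator (cbox (-2,-2) (2,2)) p * u p) = I"
    using set_borel_integral_eq_integral(2)[of "cbox (-2,-2) (2,2)" u]
    by (auto simp: set_integrable_def set_lebesgue_integral_def I_def)
  have meas: "(\<lambda>p. Complex (fst p) (snd p)) \<in> borel_measurable lborel"
    using borel_measurable_continuous_onI[OF cC] by simp
  have "indicator Q (Complex (fst p) (snd p)) = (indicator (cbox (-2,-2) (2,2)) p :: real)" for p
    by (cases p) (auto simp: Q_def indicator_def in_cbox_complex_iff)
  then have pull: "(\<lambda>p. indicator Q (Complex (fst p) (snd p)) * cmod (f (Complex (fst p) (snd p))))
      = (\<lambda>p. indicator (cbox (-2,-2) (2,2)) p * u p)"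
    by (simp add: u_def)
  have mf: "(\<lambda>z. indicator Q z * cmod (f z)) \<in> borel_measurable borel"
    using borel_measurable_continuous_onI[OF cf] unfolding Q_def by measurable
  show "integrable lborel (\<lambda>z. indicator Q z * cmod (f z))"
    unfolding lborel_complex_eq_distr using int_u by (subst integrable_distr_eq[OF meas mf]) (simp add: pull)
  have "(LINT z|lborel. indicator Q z * cmod (f z)) = I"
    unfolding lborel_complex_eq_distr by (subst integral_distr[OF meas mf]) (simp add: pull eq_u)
  with le show "cmod (f 0) \<le> (LINT z|lborel. indicator Q z * cmod (f z))" by simp
qed

text \<open>
  The translation \<open>f(z + w) exp (- \<pi> cnj z w)\<close>, with \<open>w\<close> the variable, is up to the factor
  \<open>exp (\<pi>\<bar>z\<bar>\<^sup>2/2)\<close> an isometry of the Fock space, which reduces the estimate to the origin.  There the area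
  bound is applied to the square of this function, which brings in the \<open>L\<^sup>2\<close> norm at once.
\<close>

lemma fock_pointwise_bound:
  assumes "f \<in> fock_space"
  shows "cmod (f z) \<le> sqrt (pi * exp (8 * pi)) * fock_norm f * exp (pi * (cmod z)\<^sup>2 / 2)"
proof -
  let ?Q = "cbox (Complex (-2) (-2)) (Complex 2 2)"
  let ?g = "\<lambda>w. (f (z + w) * exp (- of_real pi * cnj z * w))\<^sup>2"
  let ?h = "\<lambda>w. (cmod (f w))\<^sup>2 * exp (- pi * (cmod w)\<^sup>2)"
  have hol: "f holomorphic_on UNIV"
    using fock_space_entire[OF assms] by (simp add: entire_def)
  have "(f \<circ> (+) z) holomorphic_on UNIV"
    by (rule holomorphic_on_compose_gen[OF _ hol]) (auto intro: holomorphic_intros)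
  then have g_hol: "?g holomorphic_on UNIV"
    by (intro holomorphic_intros) (simp add: o_def)
  have g_norm: "cmod (?g w) = exp (pi * (cmod z)\<^sup>2) * exp (pi * (cmod w)\<^sup>2) * ?h (z + w)" for w
  proof -
    have *: "(cmod (z + w))\<^sup>2 = (cmod z)\<^sup>2 + (cmod w)\<^sup>2 + 2 * Re (cnj z * w)"
      unfolding cmod_power2 by (simp add: power2_eq_square algebra_simps)
    have "cmod (exp (- of_real pi * cnj z * w)) = exp (- pi * Re (cnj z * w))"
      by (simp add: algebra_simps)
    then have "(cmod (exp (- of_real pi * cnj z * w)))\<^sup>2
        = exp (pi * (cmod z)\<^sup>2) * exp (pi * (cmod w)\<^sup>2) * exp (- pi * (cmod (z + w))\<^sup>2)"
      by (simp only: exp_double[symmetric] exp_add[symmetric] *) (simp add: algebra_simps)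
    then show ?thesis
      by (simp add: norm_power norm_mult power_mult_distrib mult_ac)
  qed
  have int_h: "integrable lborel ?h" by (rule fock_space_integrable[OF assms])
  have meas_h: "?h \<in> borel_measurable borel"
    using fock_integrand_measurable[OF fock_space_entire[OF assms]] by simp
  have int_hz: "integrable lborel (\<lambda>w. ?h (z + w))"
    using int_h meas_h by (subst (asm) lborel_distr_plus[of z, symmetric]) (subst (asm) integrable_distr_eq, auto)
  have "(cmod (f z))\<^sup>2 = cmod (?g 0)" by (simp add: norm_power)
  also have "\<dots> \<le> (LINT w|lborel. indicator ?Q w * cmod (?g w))"
    by (rule norm_at_zero_le_area_integral(1)[OF g_hol])
  also have "\<dots> \<le> (LINT w|lborel. exp (pi * (cmod z)\<^sup>2) * exp (8 * pi) * ?h (z + w))"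
  proof (rule integral_mono)
    show "integrable lborel (\<lambda>w. indicator ?Q w * cmod (?g w))"
      by (rule norm_at_zero_le_area_integral(2)[OF g_hol])
    show "integrable lborel (\<lambda>w. exp (pi * (cmod z)\<^sup>2) * exp (8 * pi) * ?h (z + w))"
      by (intro integrable_mult_right int_hz)
    show "indicator ?Q w * cmod (?g w) \<le> exp (pi * (cmod z)\<^sup>2) * exp (8 * pi) * ?h (z + w)" for w
    proof (cases "w \<in> ?Q")
      case True
      then have "(Re w)\<^sup>2 \<le> 2\<^sup>2" "(Im w)\<^sup>2 \<le> 2\<^sup>2"
        unfolding abs_le_square_iff[symmetric] by (auto simp: in_cbox_complex_iff)
      then have "pi * (cmod w)\<^sup>2 \<le> pi * 8" unfolding cmod_power2 by (intro mult_left_mono) auto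
      then show ?thesis
        using True unfolding g_norm by (auto intro!: mult_right_mono)
    qed (auto intro!: mult_nonneg_nonneg)
  qed
  also have "\<dots> = exp (pi * (cmod z)\<^sup>2) * exp (8 * pi) * (LINT w|lborel. ?h (z + w))"
    by simp
  also have "(LINT w|lborel. ?h (z + w)) = (LINT w|lborel. ?h w)"
    using meas_h by (subst (2) lborel_distr_plus[of z, symmetric]) (subst integral_distr, auto)
  also have "\<dots> = pi * (fock_norm f)\<^sup>2"
    by (simp add: fock_norm_squared)
  also have "exp (pi * (cmod z)\<^sup>2) = (exp (pi * (cmod z)\<^sup>2 / 2))\<^sup>2"
    by (simp add: exp_double[symmetric])
  also have "(exp (pi * (cmod z)\<^sup>2 / 2))\<^sup>2 * exp (8 * pi) * (pi * (fock_norm f)\<^sup>2)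
      = (sqrt (pi * exp (8 * pi)) * fock_norm f * exp (pi * (cmod z)\<^sup>2 / 2))\<^sup>2"
    by (simp add: power_mult_distrib)
  finally show ?thesis
    by (rule power2_le_imp_le) auto
qed

section \<open>Closed spans of polynomial and of exponential multiples\<close>

text \<open>
  If \<open>\<bar>F(z)\<bar> exp (- \<pi>\<bar>z\<bar>\<^sup>2/2)\<close> decays faster than every exponential of \<open>\<bar>z\<bar>\<close>, then pointwise convergence \<open>g\<^sub>n \<rightarrow> f\<close> under a common exponential
  majorant gives \<open>g\<^sub>n F \<rightarrow> f F\<close> in norm, by dominated convergence.
\<close>

lemma closed_span_dominated:
  fixes g :: "nat \<Rightarrow> complex \<Rightarrow> complex"
  assumes F: "entire F" and decay: "\<And>a. \<exists>C. \<forall>z. cmod (F z) \<le> C * exp (pi * (cmod z)\<^sup>2 / 2 - a * cmod z)"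
    and ent: "entire f" "\<And>n. entire (g n)"
    and lim: "\<And>z. (\<lambda>n. g n z) \<longlonglongrightarrow> f z"
    and bound: "\<And>n z. cmod (g n z) \<le> exp (a * cmod z)"
    and span: "\<And>n. (\<lambda>z. g n z * F z) \<in> complex_span S"
  shows "(\<lambda>z. f z * F z) \<in> closed_span S"
proof -
  let ?w = "\<lambda>z. exp (- pi * (cmod z)\<^sup>2)"
  obtain C where C: "\<And>z. cmod (F z) \<le> C * exp (pi * (cmod z)\<^sup>2 / 2 - (a + 1) * cmod z)"
    using decay[of "a + 1"] by blast
  have le: "cmod (h * F z) \<le> K * C * exp (pi * (cmod z)\<^sup>2 / 2 - 1 * cmod z)"
    if "cmod h \<le> K * exp (a * cmod z)" for h K z
  proof -
    have "cmod (h * F z) \<le> K * exp (a * cmod z) * (C * exp (pi * (cmod z)\<^sup>2 / 2 - (a + 1) * cmod z))"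
      unfolding norm_mult using order_trans[OF norm_ge_zero that] by (intro mult_mono C that) auto
    also have "\<dots> = K * C * (exp (a * cmod z) * exp (pi * (cmod z)\<^sup>2 / 2 - (a + 1) * cmod z))"
      by (simp only: mult_ac)
    also have "exp (a * cmod z) * exp (pi * (cmod z)\<^sup>2 / 2 - (a + 1) * cmod z) = exp (pi * (cmod z)\<^sup>2 / 2 - 1 * cmod z)"
      unfolding exp_add[symmetric] by (rule arg_cong[where f = exp]) (simp add: algebra_simps)
    finally show ?thesis .
  qed
  have fock: "(\<lambda>z. h z * F z) \<in> fock_space" if h: "entire h" "\<And>z. cmod (h z) \<le> exp (a * cmod z)" for h
  proof (rule fock_spaceI_bound[of _ 1 "1 * C"])
    show "entire (\<lambda>z. h z * F z)"
      using h F by (auto simp: entire_def intro: holomorphic_intros)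
  qed (use le[of _ 1] h in auto)
  have fbound: "cmod (f z) \<le> exp (a * cmod z)" for z
    by (rule Lim_norm_ubound[OF _ lim]) (auto simp: bound)
  have "(\<lambda>n. LINT z|lborel. (cmod (f z * F z - g n z * F z))\<^sup>2 * ?w z) \<longlonglongrightarrow> (LINT z|(lborel::complex measure). 0)"
  proof (rule integral_dominated_convergence)
    show "integrable lborel (\<lambda>z. (2 * C)\<^sup>2 * exp (- 2 * cmod z))"
      by (intro integrable_mult_right integrable_exp_neg_norm) simp
    show "(\<lambda>z. (cmod (f z * F z - g n z * F z))\<^sup>2 * ?w z) \<in> borel_measurable lborel" for n
      by (rule fock_integrand_measurable) (use F ent in \<open>auto simp: entire_def intro!: holomorphic_intros\<close>)
    show "AE z in lborel. (\<lambda>n. (cmod (f z * F z - g n z * F z))\<^sup>2 * ?w z) \<longlonglongrightarrow> 0"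
    proof (rule AE_I2)
      fix z
      have "(\<lambda>n. (cmod (f z * F z - g n z * F z))\<^sup>2 * ?w z) \<longlonglongrightarrow> (cmod (f z * F z - f z * F z))\<^sup>2 * ?w z"
        by (intro tendsto_intros lim)
      then show "(\<lambda>n. (cmod (f z * F z - g n z * F z))\<^sup>2 * ?w z) \<longlonglongrightarrow> 0" by simp
    qed
    show "AE z in lborel. norm ((cmod (f z * F z - g n z * F z))\<^sup>2 * ?w z)
        \<le> (2 * C)\<^sup>2 * exp (- 2 * cmod z)" for n
    proof (rule AE_I2)
      fix z
      have "cmod (f z - g n z) \<le> 2 * exp (a * cmod z)"
        using norm_triangle_ineq4[of "f z" "g n z"] fbound[of z] bound[of n z] by linarith
      from le[OF this] have "(cmod (f z * F z - g n z * F z))\<^sup>2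
          \<le> (2 * C * exp (pi * (cmod z)\<^sup>2 / 2 - 1 * cmod z))\<^sup>2"
        by (intro power_mono) (auto simp: left_diff_distrib)
      then have "(cmod (f z * F z - g n z * F z))\<^sup>2 * ?w z
          \<le> (2 * C * exp (pi * (cmod z)\<^sup>2 / 2 - 1 * cmod z))\<^sup>2 * ?w z"
        by (rule mult_right_mono) simp
      also have "\<dots> = (2 * C)\<^sup>2 * exp (- 2 * cmod z)"
        by (simp add: power_mult_distrib exp_double[symmetric] exp_add[symmetric] algebra_simps)
      finally show "norm ((cmod (f z * F z - g n z * F z))\<^sup>2 * ?w z) \<le> (2 * C)\<^sup>2 * exp (- 2 * cmod z)"
        by simp
    qed
  qed auto
  then have lim0: "(\<lambda>n. (fock_norm (\<lambda>z. f z * F z - g n z * F z))\<^sup>2) \<longlonglongrightarrow> 0"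
    unfolding fock_norm_squared by (auto intro: tendsto_eq_intros)
  show ?thesis
  proof (rule closed_spanI)
    show "(\<lambda>z. f z * F z) \<in> fock_space" by (intro fock ent fbound)
    fix \<epsilon> :: real assume "0 < \<epsilon>"
    then have "eventually (\<lambda>n. (fock_norm (\<lambda>z. f z * F z - g n z * F z))\<^sup>2 < \<epsilon>\<^sup>2) sequentially"
      by (intro order_tendstoD(2)[OF lim0]) auto
    then obtain n where "(fock_norm (\<lambda>z. f z * F z - g n z * F z))\<^sup>2 < \<epsilon>\<^sup>2"
      by (auto simp: eventually_sequentially)
    then have "fock_norm (\<lambda>z. f z * F z - g n z * F z) < \<epsilon>"
      using \<open>0 < \<epsilon>\<close> by (rule power2_less_imp_less[OF _ less_imp_le])
    then show "\<exists>h. h \<in> complex_span S \<and> h \<in> fock_space \<and> fock_norm (\<lambda>z. f z * F z - h z) < \<epsilon>"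
      using span[of n] fock[OF ent(2) bound, of n] by blast
  qed
qed

lemma complex_span_polynomial_multiples:
  "complex_span {(\<lambda>z. poly p z * F z) | p :: complex poly. True} = {(\<lambda>z. poly p z * F z) | p. True}"
proof
  show "complex_span {(\<lambda>z. poly p z * F z) | p :: complex poly. True} \<subseteq> {(\<lambda>z. poly p z * F z) | p. True}"
  proof (rule complex_span_subset)
    show "(\<lambda>z. 0) \<in> {(\<lambda>z. poly p z * F z) | p. True}"
      by (auto intro!: exI[of _ 0])
  next
    fix f g assume "f \<in> {(\<lambda>z. poly p z * F z) | p. True}" "g \<in> {(\<lambda>z. poly p z * F z) | p. True}"
    then obtain p q where "f = (\<lambda>z. poly p z * F z)" "g = (\<lambda>z. poly q z * F z)" by auto
    then show "(\<lambda>z. f z + g z) \<in> {(\<lambda>z. poly p z * F z) | p. True}"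
      by (auto intro!: exI[of _ "p + q"] simp: algebra_simps)
  next
    fix f c assume "f \<in> {(\<lambda>z. poly p z * F z) | p. True}"
    then obtain p where "f = (\<lambda>z. poly p z * F z)" by auto
    then show "(\<lambda>z. c * f z) \<in> {(\<lambda>z. poly p z * F z) | p. True}"
      by (auto intro!: exI[of _ "smult c p"] simp: algebra_simps)
  qed auto
qed (auto intro: complex_span_mem)

text \<open>
  The Taylor polynomials of \<open>exp (l z)\<close> are all dominated by \<open>exp (\<bar>l\<bar>\<bar>z\<bar>)\<close>.
\<close>

lemma exp_multiple_in_closed_span_polynomials:
  assumes F: "entire F"
    and decay: "\<And>a. \<exists>C. \<forall>z. cmod (F z) \<le> C * exp (pi * (cmod z)\<^sup>2 / 2 - a * cmod z)"
  shows "(\<lambda>z. exp (l * z) * F z) \<in> closed_span {(\<lambda>z. poly p z * F z) | p :: complex poly. True}"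
proof (rule closed_span_dominated[where g = "\<lambda>n z. \<Sum>k<n. (l * z) ^ k /\<^sub>R fact k" and a = "cmod l", OF F decay])
  show "entire (\<lambda>z. exp (l * z))" "entire (\<lambda>z. \<Sum>k<n. (l * z) ^ k /\<^sub>R fact k)" for n
    by (auto simp: entire_def scaleR_conv_of_real intro!: holomorphic_intros)
  show "(\<lambda>n. \<Sum>k<n. (l * z) ^ k /\<^sub>R fact k) \<longlonglongrightarrow> exp (l * z)" for z
    using exp_converges[of "l * z"] by (simp add: sums_def)
  show "cmod (\<Sum>k<n. (l * z) ^ k /\<^sub>R fact k) \<le> exp (cmod l * cmod z)" for n z
  proof -
    have "cmod (\<Sum>k<n. (l * z) ^ k /\<^sub>R fact k) \<le> (\<Sum>k<n. (cmod l * cmod z) ^ k /\<^sub>R fact k)"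
      by (rule sum_norm_le) (auto simp: norm_mult norm_power power_mult_distrib)
    also have "\<dots> \<le> exp (cmod l * cmod z)"
      unfolding exp_def by (rule sum_le_suminf) (use summable_exp_generic[of "cmod l * cmod z"] in \<open>auto simp: field_simps\<close>)
    finally show ?thesis .
  qed
  show "(\<lambda>z. (\<Sum>k<n. (l * z) ^ k /\<^sub>R fact k) * F z)
      \<in> complex_span {(\<lambda>z. poly p z * F z) | p :: complex poly. True}" for n
    unfolding complex_span_polynomial_multiples
    by (auto intro!: exI[of _ "\<Sum>k<n. monom (l ^ k / fact k) k"]
        simp: poly_sum poly_monom scaleR_conv_of_real power_mult_distrib field_simps)
qed

lemma exp_difference_in_span:
  "(\<lambda>z. (exp (h * z) - 1) ^ k * exp (l * z) * F z) \<in> complex_span {(\<lambda>z. exp (l * z) * F z) | l. True}"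
proof (induction k arbitrary: l)
  case 0
  show ?case by (auto intro!: complex_span_mem)
next
  case (Suc k)
  have "(\<lambda>z. (exp (h * z) - 1) ^ Suc k * exp (l * z) * F z)
      = (\<lambda>z. (exp (h * z) - 1) ^ k * exp ((h + l) * z) * F z - (exp (h * z) - 1) ^ k * exp (l * z) * F z)"
    by (auto simp: algebra_simps exp_add)
  then show ?case
    using complex_span_diff[OF Suc.IH[of "h + l"] Suc.IH[of l]] by simp
qed

lemma norm_exp_minus_one_le: "cmod (exp z - 1) \<le> cmod z * exp (cmod z)"
proof -
  have "cmod (exp z - exp 0) \<le> exp (cmod z) * cmod (z - 0)"
  proof (rule field_differentiable_bound[where S = "cball 0 (cmod z)" and f' = exp])
    show "(exp has_field_derivative exp w) (at w within cball 0 (cmod z))" for w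
      by (auto intro: has_field_derivative_at_within DERIV_exp)
    show "cmod (exp w) \<le> exp (cmod z)" if "w \<in> cball 0 (cmod z)" for w
      using that complex_Re_le_cmod[of w] by (simp add: dist_norm)
  qed auto
  then show ?thesis by (simp add: mult_ac)
qed

text \<open>
  The powers \<open>(N (exp (z/N) - 1))\<^sup>k\<close> of difference quotients are combinations of exponentials; they tend
  to \<open>z\<^sup>k\<close> and are dominated by \<open>exp (2k\<bar>z\<bar>)\<close>.
\<close>

lemma monomial_multiple_in_closed_span_exps:
  assumes F: "entire F"
    and decay: "\<And>a. \<exists>C. \<forall>z. cmod (F z) \<le> C * exp (pi * (cmod z)\<^sup>2 / 2 - a * cmod z)"
  shows "(\<lambda>z. z ^ k * F z) \<in> closed_span {(\<lambda>z. exp (l * z) * F z) | l :: complex. True}"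
proof (rule closed_span_dominated[where a = "2 * real k" and
    g = "\<lambda>n z. (of_nat (Suc n) * (exp (1 / of_nat (Suc n) * z) - 1)) ^ k", OF F decay])
  show "entire (\<lambda>z. z ^ k)" "entire (\<lambda>z. (of_nat (Suc n) * (exp (1 / of_nat (Suc n) * z) - 1)) ^ k)" for n
    by (auto simp: entire_def intro!: holomorphic_intros)
  show "(\<lambda>n. (of_nat (Suc n) * (exp (1 / of_nat (Suc n) * z) - 1)) ^ k) \<longlonglongrightarrow> z ^ k" for z :: complex
  proof (rule tendsto_power)
    have "((\<lambda>t. exp (t * z)) has_field_derivative exp (0 * z) * z) (at (0::complex))"
      by (auto intro!: derivative_eq_intros)
    then have "((\<lambda>t. (exp (t * z) - 1) / t) \<longlongrightarrow> z) (at 0)"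
      by (simp add: has_field_derivative_iff)
    moreover have "filterlim (\<lambda>n. 1 / of_nat (Suc n) :: complex) (at 0) sequentially"
      unfolding filterlim_at
    proof
      show "(\<lambda>n. 1 / of_nat (Suc n) :: complex) \<longlonglongrightarrow> 0"
        using LIMSEQ_inverse_real_of_nat tendsto_norm_zero_iff[of "\<lambda>n. 1 / of_nat (Suc n) :: complex" sequentially]
        by (simp add: norm_divide divide_simps del: of_nat_Suc)
    qed (auto simp del: of_nat_Suc)
    ultimately have "(\<lambda>n. (exp (1 / of_nat (Suc n) * z) - 1) / (1 / of_nat (Suc n))) \<longlonglongrightarrow> z"
      by (rule filterlim_compose)
    then show "(\<lambda>n. of_nat (Suc n) * (exp (1 / of_nat (Suc n) * z) - 1)) \<longlonglongrightarrow> z"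
      by (simp add: mult_ac)
  qed
  show "cmod ((of_nat (Suc n) * (exp (1 / of_nat (Suc n) * z) - 1)) ^ k) \<le> exp (2 * real k * cmod z)" for n z
  proof -
    let ?N = "of_nat (Suc n) :: complex"
    have "cmod (?N * (exp (1 / ?N * z) - 1)) \<le> real (Suc n) * (cmod (1 / ?N * z) * exp (cmod (1 / ?N * z)))"
      unfolding norm_mult[of ?N] norm_of_nat by (intro mult_left_mono norm_exp_minus_one_le) auto
    also have "\<dots> = cmod z * exp (cmod z / real (Suc n))"
      by (simp add: norm_mult norm_divide del: of_nat_Suc)
    also have "\<dots> \<le> exp (cmod z) * exp (cmod z)"
    proof (intro mult_mono)
      show "cmod z \<le> exp (cmod z)" using exp_ge_add_one_self[of "cmod z"] by linarith
      have "cmod z * 1 \<le> cmod z * real (Suc n)" by (intro mult_left_mono) auto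
      then show "exp (cmod z / real (Suc n)) \<le> exp (cmod z)"
        by (simp add: divide_simps del: of_nat_Suc)
    qed auto
    finally have "cmod (?N * (exp (1 / ?N * z) - 1)) \<le> exp (2 * cmod z)"
      by (simp add: exp_add[symmetric])
    then have "cmod (?N * (exp (1 / ?N * z) - 1)) ^ k \<le> exp (2 * cmod z) ^ k"
      by (rule power_mono) auto
    then show ?thesis
      by (simp add: norm_power exp_of_nat_mult[symmetric] mult_ac del: of_nat_Suc)
  qed
  fix n
  have "(\<lambda>z. of_nat (Suc n) ^ k * ((exp (1 / of_nat (Suc n) * z) - 1) ^ k * exp (0 * z) * F z))
      \<in> complex_span {(\<lambda>z. exp (l * z) * F z) | l :: complex. True}"
    by (intro complex_span_cmult exp_difference_in_span)
  then show "(\<lambda>z. (of_nat (Suc n) * (exp (1 / of_nat (Suc n) * z) - 1)) ^ k * F z)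
      \<in> complex_span {(\<lambda>z. exp (l * z) * F z) | l :: complex. True}"
    by (simp add: power_mult_distrib mult_ac del: of_nat_Suc)
qed

theorem closed_span_polynomials_eq_exps:
  assumes F: "entire F"
    and decay: "\<And>a. \<exists>C. \<forall>z. cmod (F z) \<le> C * exp (pi * (cmod z)\<^sup>2 / 2 - a * cmod z)"
  shows "closed_span {(\<lambda>z. poly p z * F z) | p :: complex poly. True}
        = closed_span {(\<lambda>z. exp (l * z) * F z) | l :: complex. True}"
proof (intro equalityI closed_span_subset)
  let ?E = "closed_span {(\<lambda>z. exp (l * z) * F z) | l :: complex. True}"
  have "(\<lambda>z. (\<Sum>k\<in>A. coeff p k * z ^ k) * F z) \<in> ?E" if "finite A" for A and p :: "complex poly"
    using that
  proof induction
    case empty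
    show ?case
      using closed_span_cmult[OF monomial_multiple_in_closed_span_exps[OF F decay, of 0], of 0] by simp
  next
    case (insert k A)
    have "(\<lambda>z. coeff p k * (z ^ k * F z) + (\<Sum>k\<in>A. coeff p k * z ^ k) * F z) \<in> ?E"
      by (intro closed_span_add insert.IH closed_span_cmult monomial_multiple_in_closed_span_exps F decay)
    then show ?case using insert.hyps by (simp add: algebra_simps)
  qed
  then show "{(\<lambda>z. poly p z * F z) | p :: complex poly. True} \<subseteq> ?E"
    by (auto simp: poly_altdef)
  show "{(\<lambda>z. exp (l * z) * F z) | l :: complex. True}
      \<subseteq> closed_span {(\<lambda>z. poly p z * F z) | p :: complex poly. True}"
    using exp_multiple_in_closed_span_polynomials[OF F decay] by auto
qed

section \<open>Polynomials in a sector\<close>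

lemma powr_le_powr_plus:
  fixes a \<beta> k :: real
  assumes "0 < a" "a < \<beta>" "0 < k"
  obtains C where "\<And>x. 0 \<le> x \<Longrightarrow> x powr a \<le> k * x powr \<beta> + C"
proof
  define X where "X = (1 / k) powr (1 / (\<beta> - a))"
  fix x :: real assume "0 \<le> x"
  show "x powr a \<le> k * x powr \<beta> + X powr a"
  proof (cases "x \<le> X")
    case True
    then have "x powr a \<le> X powr a" using \<open>0 \<le> x\<close> assms by (intro powr_mono2) auto
    then show ?thesis using \<open>0 < k\<close> by (simp add: add_increasing)
  next
    case False
    have "X > 0" using \<open>0 < k\<close> by (simp add: X_def)
    then have "x > 0" using False by linarith
    have "1 = k * X powr (\<beta> - a)" using assms by (simp add: X_def powr_powr)
    also have "\<dots> \<le> k * x powr (\<beta> - a)"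
      using False assms \<open>X > 0\<close> by (intro mult_left_mono powr_mono2) auto
    finally have "x powr a * 1 \<le> x powr a * (k * x powr (\<beta> - a))"
      by (intro mult_left_mono) auto
    also have "\<dots> = k * x powr \<beta>"
      using \<open>x > 0\<close> by (simp add: powr_add[symmetric])
    finally show ?thesis by (simp add: add_increasing2)
  qed
qed


lemma poly_norm_le_power:
  fixes p :: "complex poly"
  obtains C N where "0 \<le> C" "\<And>z. cmod (poly p z) \<le> C * (1 + cmod z) ^ N"
proof -
  have "\<exists>C N. 0 \<le> C \<and> (\<forall>z. cmod (poly p z) \<le> C * (1 + cmod z) ^ N)"
  proof (induction p)
    case 0
    show ?case by auto
  next
    case (pCons a p)
    then obtain C N where CN: "0 \<le> C" "\<And>z. cmod (poly p z) \<le> C * (1 + cmod z) ^ N" by blast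
    have "cmod (poly (pCons a p) z) \<le> (cmod a + C) * (1 + cmod z) ^ Suc N" for z
    proof -
      have "cmod (poly (pCons a p) z) \<le> cmod a + cmod z * cmod (poly p z)"
        using norm_triangle_ineq[of a "z * poly p z"] by (simp add: norm_mult)
      also have "\<dots> \<le> cmod a * (1 + cmod z) ^ Suc N + (1 + cmod z) * (C * (1 + cmod z) ^ N)"
      proof (intro add_mono mult_mono CN)
        show "cmod a \<le> cmod a * (1 + cmod z) ^ Suc N"
          using mult_left_mono[OF one_le_power[of "1 + cmod z" "Suc N"], of "cmod a"] by simp
      qed (use CN in auto)
      finally show ?thesis by (simp add: algebra_simps)
    qed
    then show ?case
      using CN(1) by (intro exI[of _ "cmod a + C"] exI[of _ "Suc N"]) auto
  qed
  then show ?thesis using that by blast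
qed

lemma cos_le_cos_abs:
  assumes "\<bar>s\<bar> \<le> t" "t \<le> pi"
  shows "cos t \<le> cos s"
  using assms cos_monotone_0_pi_le[of "\<bar>s\<bar>" t] by simp

text \<open>
  A Phragmen-Lindeloef estimate in the sector \<open>\<bar>arg z\<bar> \<le> \<theta>\<close>.  The multiplier \<open>exp (- z\<^sup>b)\<close> decays in the
  sector and so tames the polynomial at infinity.  In the coordinate \<open>z = exp \<zeta>\<close> the sector is a strip
  and no branch of \<open>z\<^sup>b\<close> has to be chosen; the maximum principle is applied on a long rectangle in the
  strip.  Its left edge lies near \<open>z = 0\<close>, where the function is close to a value of modulus at most
  \<open>M\<close>; the factor \<open>2\<close> pays for this approximation.
\<close>

lemma poly_bound_on_sector:
  fixes p :: "complex poly"
  assumes b: "0 < b" and \<theta>: "0 < \<theta>" "b * \<theta> < pi / 2"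
    and M: "0 < M"
    and bound: "\<And>r. 0 \<le> r \<Longrightarrow> cmod (poly p (of_real r * cis \<theta>)) \<le> M * exp (r powr b * cos (b * \<theta>))"
      "\<And>r. 0 \<le> r \<Longrightarrow> cmod (poly p (of_real r * cis (- \<theta>))) \<le> M * exp (r powr b * cos (b * \<theta>))"
    and x: "0 < x"
  shows "cmod (poly p (of_real x)) \<le> 2 * M * exp (x powr b)"
proof -
  define f where "f = (\<lambda>\<zeta>. poly p (exp \<zeta>) * exp (- exp (of_real b * \<zeta>)))"
  define k where "k = cos (b * \<theta>)"
  have k: "0 < k" unfolding k_def using b \<theta> by (intro cos_gt_zero_pi) (auto intro: less_trans[of _ 0])
  have f_norm: "cmod (f \<zeta>) = cmod (poly p (of_real (exp (Re \<zeta>)) * cis (Im \<zeta>)))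
      * exp (- (exp (Re \<zeta>) powr b * cos (b * Im \<zeta>)))" for \<zeta>
  proof -
    have "exp \<zeta> = of_real (exp (Re \<zeta>)) * cis (Im \<zeta>)" by (simp add: exp_eq_polar)
    moreover have "Re (exp (of_real b * \<zeta>)) = exp (Re \<zeta>) powr b * cos (b * Im \<zeta>)"
      by (simp add: Re_exp powr_def)
    ultimately show ?thesis by (simp add: f_def norm_mult)
  qed
  have f_le: "cmod (f \<zeta>) \<le> cmod (poly p (of_real (exp (Re \<zeta>)) * cis (Im \<zeta>))) * exp (- (exp (Re \<zeta>) powr b * k))"
    if "\<bar>Im \<zeta>\<bar> \<le> \<theta>" for \<zeta>
  proof -
    have "b * \<theta> \<le> pi" using \<theta>(2) pi_gt_zero by linarith
    then have "k \<le> cos (b * Im \<zeta>)"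
      unfolding k_def using that b \<theta> by (intro cos_le_cos_abs) (auto simp: abs_mult)
    then show ?thesis unfolding f_norm by (intro mult_left_mono) (auto intro!: mult_left_mono)
  qed
  have right: "eventually (\<lambda>L. \<forall>\<zeta>. Re \<zeta> = L \<longrightarrow> \<bar>Im \<zeta>\<bar> \<le> \<theta> \<longrightarrow> cmod (f \<zeta>) \<le> 2 * M) at_top"
  proof -
    obtain C N where CN: "0 \<le> C" "\<And>z. cmod (poly p z) \<le> C * (1 + cmod z) ^ N"
      using poly_norm_le_power by blast
    have "((\<lambda>r. C * (1 + r) ^ N * exp (- (r powr b * k))) \<longlongrightarrow> 0) at_top"
      using b k by real_asymp
    then have "((\<lambda>L. C * (1 + exp L) ^ N * exp (- (exp L powr b * k))) \<longlongrightarrow> 0) at_top"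
      by (rule filterlim_compose[OF _ exp_at_top])
    then have "eventually (\<lambda>L. C * (1 + exp L) ^ N * exp (- (exp L powr b * k)) < 2 * M) at_top"
      using M by (intro order_tendstoD(2)) auto
    then show ?thesis
    proof eventually_elim
      case (elim L)
      show ?case
      proof (intro allI impI)
        fix \<zeta> assume \<zeta>: "Re \<zeta> = L" "\<bar>Im \<zeta>\<bar> \<le> \<theta>"
        have "cmod (f \<zeta>) \<le> C * (1 + exp L) ^ N * exp (- (exp L powr b * k))"
          using f_le[OF \<zeta>(2)] CN(2)[of "of_real (exp L) * cis (Im \<zeta>)"] unfolding \<zeta>(1)
          by (elim order_trans) (auto intro!: mult_right_mono simp: norm_mult)
        then show "cmod (f \<zeta>) \<le> 2 * M" using elim by linarith
      qed
    qed
  qed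
  have left: "eventually (\<lambda>L. \<forall>\<zeta>. Re \<zeta> = - L \<longrightarrow> \<bar>Im \<zeta>\<bar> \<le> \<theta> \<longrightarrow> cmod (f \<zeta>) \<le> 2 * M) at_top"
  proof -
    have "cmod (poly p 0) < 2 * M"
      using bound(1)[of 0] M b by simp
    moreover have "((\<lambda>z. cmod (poly p z)) \<longlongrightarrow> cmod (poly p 0)) (nhds 0)"
      by (intro tendsto_intros) (auto simp: filterlim_ident)
    ultimately have "eventually (\<lambda>z. cmod (poly p z) < 2 * M) (nhds 0)"
      by (metis order_tendstoD(2))
    then obtain d where d: "0 < d" "\<And>z. cmod z < d \<Longrightarrow> cmod (poly p z) < 2 * M"
      by (auto simp: eventually_nhds_metric dist_norm)
    have "((\<lambda>L::real. exp (- L)) \<longlongrightarrow> 0) at_top" by real_asymp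
    then have "eventually (\<lambda>L::real. exp (- L) < d) at_top"
      using d by (intro order_tendstoD(2)) auto
    then show ?thesis
    proof eventually_elim
      case (elim L)
      show ?case
      proof (intro allI impI)
        fix \<zeta> assume \<zeta>: "Re \<zeta> = - L" "\<bar>Im \<zeta>\<bar> \<le> \<theta>"
        have "cmod (f \<zeta>) \<le> cmod (poly p (of_real (exp (- L)) * cis (Im \<zeta>))) * 1"
          using f_le[OF \<zeta>(2)] k unfolding \<zeta>(1) by (elim order_trans) (intro mult_left_mono, auto)
        also have "\<dots> < 2 * M"
          using elim d(2)[of "of_real (exp (- L)) * cis (Im \<zeta>)"] by (simp add: norm_mult)
        finally show "cmod (f \<zeta>) \<le> 2 * M" by simp
      qed
    qed
  qed
  obtain L where L: "\<bar>ln x\<bar> < L"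
    "\<And>\<zeta>. Re \<zeta> = L \<Longrightarrow> \<bar>Im \<zeta>\<bar> \<le> \<theta> \<Longrightarrow> cmod (f \<zeta>) \<le> 2 * M"
    "\<And>\<zeta>. Re \<zeta> = - L \<Longrightarrow> \<bar>Im \<zeta>\<bar> \<le> \<theta> \<Longrightarrow> cmod (f \<zeta>) \<le> 2 * M"
    using eventually_happens[OF eventually_conj[OF eventually_gt_at_top[of "\<bar>ln x\<bar>"] eventually_conj[OF right left]]]
    by auto
  define S where "S = box (Complex (- L) (- \<theta>)) (Complex L \<theta>)"
  have S: "\<zeta> \<in> S \<longleftrightarrow> \<bar>Re \<zeta>\<bar> < L \<and> \<bar>Im \<zeta>\<bar> < \<theta>" for \<zeta>
    by (auto simp: S_def in_box_complex_iff abs_less_iff)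
  have hol: "f holomorphic_on A" for A
  proof -
    have "(\<lambda>\<zeta>. poly p (exp \<zeta>)) holomorphic_on A"
      unfolding poly_altdef by (intro holomorphic_intros)
    then show ?thesis unfolding f_def by (intro holomorphic_intros)
  qed
  have "cmod (f (of_real (ln x))) \<le> 2 * M"
  proof (rule maximum_modulus_frontier[of f S])
    show "bounded S" by (simp add: S_def)
    show "of_real (ln x) \<in> S" using L \<theta> by (simp add: S)
    fix \<zeta> assume "\<zeta> \<in> frontier S"
    then have "\<zeta> \<in> closure S" "\<zeta> \<notin> S"
      by (auto simp: frontier_def S_def interior_open[OF open_box])
    moreover have "closure S \<subseteq> cbox (Complex (- L) (- \<theta>)) (Complex L \<theta>)"
      unfolding S_def by (rule closure_minimal) (auto simp: box_subset_cbox)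
    ultimately have in_cbox: "\<zeta> \<in> cbox (Complex (- L) (- \<theta>)) (Complex L \<theta>)" by auto
    then have le: "\<bar>Re \<zeta>\<bar> \<le> L" "\<bar>Im \<zeta>\<bar> \<le> \<theta>" by (auto simp: in_cbox_complex_iff)
    with \<open>\<zeta> \<notin> S\<close> consider "Re \<zeta> = L" | "Re \<zeta> = - L" | "Im \<zeta> = \<theta>" | "Im \<zeta> = - \<theta>"
      unfolding S by linarith
    then show "cmod (f \<zeta>) \<le> 2 * M"
    proof cases
      case 3
      then have "cmod (f \<zeta>) \<le> M * exp (exp (Re \<zeta>) powr b * k) * exp (- (exp (Re \<zeta>) powr b * k))"
        using bound(1)[of "exp (Re \<zeta>)"] f_le[OF le(2)] unfolding k_def
        by (elim order_trans) (auto intro: mult_right_mono)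
      also have "\<dots> = M" by (simp add: exp_minus)
      finally show ?thesis using M by simp
    next
      case 4
      then have "cmod (f \<zeta>) \<le> M * exp (exp (Re \<zeta>) powr b * k) * exp (- (exp (Re \<zeta>) powr b * k))"
        using bound(2)[of "exp (Re \<zeta>)"] f_le[OF le(2)] unfolding k_def
        by (elim order_trans) (auto intro: mult_right_mono)
      also have "\<dots> = M" by (simp add: exp_minus)
      finally show ?thesis using M by simp
    qed (use L le in auto)
  qed (use hol in \<open>auto intro: holomorphic_on_imp_continuous_on\<close>)
  then have "cmod (poly p (of_real x)) * exp (- (x powr b)) \<le> 2 * M"
    unfolding f_norm using x by simp
  then show ?thesis
    by (simp add: exp_minus divide_simps)
qed

text \<open>
  Since \<open>\<beta> < b\<close>, growth \<open>exp (r\<^sup>\<beta>)\<close> on the rays is, up to a constant, below the growth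
  \<open>exp (r\<^sup>b cos (b\<theta>))\<close> allowed there; the constant \<open>K\<close> is the same for all polynomials.
\<close>

lemma poly_bound_on_axis_of_rays:
  fixes p :: "complex poly"
  assumes "0 < \<beta>" "\<beta> < b" "0 < \<theta>" "b * \<theta> < pi / 2"
  obtains K where "0 < K"
    "\<And>p D x. \<lbrakk>0 < D; \<And>r t. \<lbrakk>0 \<le> r; t = \<theta> \<or> t = - \<theta>\<rbrakk> \<Longrightarrow> cmod (poly p (of_real r * cis t)) \<le> D * exp (r powr \<beta>);
       0 < x\<rbrakk> \<Longrightarrow> cmod (poly p (of_real x)) \<le> K * D * exp (x powr b)"
proof -
  have "0 < cos (b * \<theta>)"
    using assms by (intro cos_gt_zero_pi) (auto intro: less_trans[of _ 0])
  then obtain C where C: "\<And>r. 0 \<le> r \<Longrightarrow> r powr \<beta> \<le> cos (b * \<theta>) * r powr b + C"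
    using powr_le_powr_plus[OF assms(1,2)] by metis
  show ?thesis
  proof (rule that[of "2 * exp C"])
    fix p :: "complex poly" and D x :: real
    assume D: "0 < D" and x: "0 < x"
      and p: "\<And>r t. \<lbrakk>0 \<le> r; t = \<theta> \<or> t = - \<theta>\<rbrakk> \<Longrightarrow> cmod (poly p (of_real r * cis t)) \<le> D * exp (r powr \<beta>)"
    have "cmod (poly p (of_real r * cis t)) \<le> (exp C * D) * exp (r powr b * cos (b * \<theta>))"
      if "0 \<le> r" "t = \<theta> \<or> t = - \<theta>" for r t
    proof -
      have "exp (r powr \<beta>) \<le> exp C * exp (r powr b * cos (b * \<theta>))"
        using C[OF that(1)] by (simp add: exp_add[symmetric] mult_ac add_ac)
      then have "D * exp (r powr \<beta>) \<le> D * (exp C * exp (r powr b * cos (b * \<theta>)))"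
        using D by (intro mult_left_mono) auto
      then show ?thesis using p[OF that] by (simp add: mult_ac)
    qed
    then have "cmod (poly p (of_real x)) \<le> 2 * (exp C * D) * exp (x powr b)"
      using assms D x by (intro poly_bound_on_sector[of b \<theta>]) auto
    then show "cmod (poly p (of_real x)) \<le> 2 * exp C * D * exp (x powr b)" by (simp add: mult_ac)
  qed auto
qed


section \<open>Gaussian bumps along a ray\<close>

text \<open>
  Up to the factor \<open>exp (- n\<^sup>\<beta>)\<close> the \<open>n\<close>-th term is a multiple of the reproducing kernel at the point \<open>n\<close>; its
  modulus is \<open>exp (\<pi>\<bar>z\<bar>\<^sup>2/2 - \<pi>\<bar>z - n\<bar>\<^sup>2/2)\<close>.
\<close>

definition gauss_train :: "real \<Rightarrow> complex \<Rightarrow> complex" where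
  "gauss_train \<beta> z = (\<Sum>n. exp (of_real (- (real n powr \<beta>) - pi * (real n)\<^sup>2 / 2)) * exp (of_nat n * (of_real pi * z)))"

text \<open>
  Half of the Gaussian decay in the direction of \<open>Im z\<close> is kept on the right-hand side; it later absorbs
  the growth of \<open>exp (c z\<^sup>2)\<close>.  The other half still gives \<open>exp (- \<bar>z\<bar>\<^sup>\<beta>/16)\<close>: if \<open>\<bar>z\<bar> \<le> 2n\<close> then \<open>n\<^sup>\<beta>\<close> is
  comparable with \<open>\<bar>z\<bar>\<^sup>\<beta>\<close>, otherwise \<open>\<bar>z - n\<bar> \<ge> \<bar>z\<bar>/2\<close>.  The summand \<open>n/2\<close> makes the series converge.
\<close>

lemma gauss_train_exponent_bound:
  fixes z :: complex
  assumes "1 \<le> \<beta>" "\<beta> \<le> 2"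
  shows "- (real n powr \<beta>) - pi * (real n)\<^sup>2 / 2 + real n * (pi * Re z)
    \<le> pi * (cmod z)\<^sup>2 / 2 - pi * (Im z)\<^sup>2 / 4 - cmod z powr \<beta> / 16 + 1 - real n / 2"
proof -
  define t where "t = cmod (z - of_nat n)"
  have t2: "t\<^sup>2 = (Re z - real n)\<^sup>2 + (Im z)\<^sup>2" by (simp add: t_def cmod_power2)
  have n: "real n \<le> real n powr \<beta>"
    using assms powr_mono[of 1 \<beta> "real n"] by (cases "n = 0") auto
  have "cmod z powr \<beta> / 16 + real n / 2 \<le> real n powr \<beta> + pi * t\<^sup>2 / 4 + 1"
  proof (cases "cmod z \<le> 2 * real n")
    case True
    have "cmod z powr \<beta> \<le> (2 * real n) powr \<beta>"
      using True assms by (intro powr_mono2) auto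
    also have "\<dots> = 2 powr \<beta> * real n powr \<beta>" by (simp add: powr_mult)
    also have "\<dots> \<le> 2 powr 2 * real n powr \<beta>"
      using assms by (intro mult_right_mono powr_mono) auto
    finally have "cmod z powr \<beta> \<le> 4 * real n powr \<beta>" by simp
    moreover have "0 \<le> pi * t\<^sup>2" by simp
    ultimately show ?thesis using n powr_ge_zero[of "real n" \<beta>] by linarith
  next
    case False
    have "cmod z \<le> t + real n"
      unfolding t_def using norm_triangle_ineq[of "z - of_nat n" "of_nat n"] by simp
    then have "cmod z / 2 \<le> t" using False by linarith
    then have "(cmod z / 2)\<^sup>2 \<le> t\<^sup>2" by (intro power_mono) auto
    then have "1 * (cmod z)\<^sup>2 / 4 \<le> pi * t\<^sup>2"
      using pi_gt3 mult_mono[of 1 pi "(cmod z / 2)\<^sup>2" "t\<^sup>2"] by (simp add: power_divide)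
    moreover have "cmod z powr \<beta> \<le> 1 + (cmod z)\<^sup>2"
    proof (cases "cmod z \<le> 1")
      case True
      then have "cmod z powr \<beta> \<le> 1" using assms by (intro powr_le1) auto
      then show ?thesis by (simp add: add_increasing2)
    next
      case False
      then have "cmod z powr \<beta> \<le> cmod z powr 2" using assms by (intro powr_mono) auto
      then show ?thesis using False by simp
    qed
    ultimately show ?thesis using n powr_ge_zero[of "real n" \<beta>] by linarith
  qed
  moreover have "- pi * (real n)\<^sup>2 / 2 + real n * (pi * Re z) - pi * (cmod z)\<^sup>2 / 2 + pi * (Im z)\<^sup>2 / 4
      = - pi * t\<^sup>2 / 4 - pi * (Re z - real n)\<^sup>2 / 4"
    unfolding t2 cmod_power2 by (simp add: power2_eq_square field_simps)
  moreover have "0 \<le> pi * (Re z - real n)\<^sup>2 / 4" by simp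
  ultimately show ?thesis by linarith
qed

lemma gauss_train_term_norm:
  "cmod (exp (of_real (- (real n powr \<beta>) - pi * (real n)\<^sup>2 / 2)) * exp (of_nat n * (of_real pi * z)))
    = exp (- (real n powr \<beta>) - pi * (real n)\<^sup>2 / 2 + real n * (pi * Re z))"
  by (simp add: norm_mult exp_add)

lemma gauss_train_term_bound:
  assumes "1 \<le> \<beta>" "\<beta> \<le> 2"
  shows "cmod (exp (of_real (- (real n powr \<beta>) - pi * (real n)\<^sup>2 / 2)) * exp (of_nat n * (of_real pi * z)))
    \<le> exp (pi * (cmod z)\<^sup>2 / 2 - pi * (Im z)\<^sup>2 / 4 - cmod z powr \<beta> / 16 + 1) * exp (- 1 / 2) ^ n"
  unfolding gauss_train_term_norm exp_of_nat_mult[symmetric] exp_add[symmetric]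
  using gauss_train_exponent_bound[OF assms, of n z] by simp

lemma summable_gauss_train_majorant: "summable (\<lambda>n. c * exp (- 1 / 2 :: real) ^ n)"
  by (intro summable_mult summable_geometric) auto

lemma summable_gauss_train:
  assumes "1 \<le> \<beta>" "\<beta> \<le> 2"
  shows "summable (\<lambda>n. exp (of_real (- (real n powr \<beta>) - pi * (real n)\<^sup>2 / 2)) * exp (of_nat n * (of_real pi * z)) :: complex)"
  by (rule summable_comparison_test'[OF summable_gauss_train_majorant gauss_train_term_bound[OF assms]])

lemma gauss_train_bound:
  assumes "1 \<le> \<beta>" "\<beta> \<le> 2"
  obtains C where "0 < C"
    "\<And>z. cmod (gauss_train \<beta> z) \<le> C * exp (pi * (cmod z)\<^sup>2 / 2 - pi * (Im z)\<^sup>2 / 4 - cmod z powr \<beta> / 16)"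
proof
  let ?C = "exp 1 * (\<Sum>n. exp (- 1 / 2 :: real) ^ n)"
  show "0 < ?C"
    using summable_gauss_train_majorant[of 1] by (intro mult_pos_pos suminf_pos) auto
  fix z
  let ?E = "exp (pi * (cmod z)\<^sup>2 / 2 - pi * (Im z)\<^sup>2 / 4 - cmod z powr \<beta> / 16 + 1)"
  have "cmod (gauss_train \<beta> z) \<le> (\<Sum>n. ?E * exp (- 1 / 2) ^ n)"
    unfolding gauss_train_def
    by (rule norm_suminf_le[OF gauss_train_term_bound[OF assms] summable_gauss_train_majorant])
  also have "\<dots> = ?E * (\<Sum>n. exp (- 1 / 2) ^ n)"
    using summable_gauss_train_majorant[of 1] by (intro suminf_mult) auto
  also have "\<dots> = ?C * exp (pi * (cmod z)\<^sup>2 / 2 - pi * (Im z)\<^sup>2 / 4 - cmod z powr \<beta> / 16)"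
    by (simp add: exp_add[symmetric] mult_ac)
  finally show "cmod (gauss_train \<beta> z) \<le> ?C * exp (pi * (cmod z)\<^sup>2 / 2 - pi * (Im z)\<^sup>2 / 4 - cmod z powr \<beta> / 16)" .
qed

text \<open>
  The series is a power series in \<open>exp (\<pi>z)\<close>, convergent everywhere.
\<close>

lemma entire_gauss_train:
  assumes "1 \<le> \<beta>" "\<beta> \<le> 2"
  shows "entire (gauss_train \<beta>)"
proof -
  define c where "c n = (exp (of_real (- (real n powr \<beta>) - pi * (real n)\<^sup>2 / 2)) :: complex)" for n
  have sm: "summable (\<lambda>n. c n * exp (of_nat n * (of_real pi * z)))" for z
    using summable_gauss_train[OF assms] by (simp add: c_def)
  have "summable (\<lambda>n. c n * y ^ n)" for y :: complex
  proof (cases "y = 0")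
    case True
    then show ?thesis by (simp add: power_0_left if_distrib cong: if_cong)
  next
    case False
    then show ?thesis
      using sm[of "Ln y / of_real pi"] by (simp add: exp_of_nat_mult)
  qed
  then have D: "((\<lambda>y. \<Sum>n. c n * y ^ n) has_field_derivative (\<Sum>n. diffs c n * y ^ n)) (at y)" for y
    by (rule termdiffs_strong_converges_everywhere)
  then have "(\<lambda>y. \<Sum>n. c n * y ^ n) holomorphic_on UNIV"
    by (auto simp: holomorphic_on_def field_differentiable_def intro: has_field_derivative_at_within)
  then have "((\<lambda>y. \<Sum>n. c n * y ^ n) \<circ> (\<lambda>z. exp (of_real pi * z))) holomorphic_on UNIV"
    by (intro holomorphic_on_compose_gen[of _ _ _ UNIV] holomorphic_intros) auto
  moreover have "(\<lambda>y. \<Sum>n. c n * y ^ n) \<circ> (\<lambda>z. exp (of_real pi * z)) = gauss_train \<beta>"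
    by (auto simp: gauss_train_def c_def exp_of_nat_mult fun_eq_iff)
  ultimately show ?thesis by (simp add: entire_def)
qed

lemma gauss_train_periodic: "gauss_train \<beta> (z + 2 * of_int k * \<i>) = gauss_train \<beta> z"
proof -
  have "exp (of_nat n * (of_real pi * (z + 2 * of_int k * \<i>))) = exp (of_nat n * (of_real pi * z))" for n
  proof -
    have "exp (of_nat n * (of_real pi * (z + 2 * of_int k * \<i>)))
        = exp (of_nat n * (of_real pi * z) + 2 * of_real pi * of_int (int n * k) * \<i>)"
      by (simp add: algebra_simps)
    also have "\<dots> = exp (of_nat n * (of_real pi * z))"
      using exp_plus_2pin[of "of_nat n * (of_real pi * z)" "int n * k"] by (simp add: mult_ac)
    finally show ?thesis .
  qed
  then show ?thesis by (simp add: gauss_train_def)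
qed

text \<open>
  All terms of the series at a real point are positive, and they dominate the corresponding terms at
  any \<open>w\<close> with \<open>Re w \<le> x\<close>.  Hence the real parts of the sum have no cancellation and any single
  term is a lower bound.
\<close>

lemma gauss_train_sum_ge_term:
  assumes "1 \<le> \<beta>" "\<beta> \<le> 2" and "Re w \<le> x"
  shows "exp (- (real n powr \<beta>) - pi * (real n)\<^sup>2 / 2) * (exp (real n * (pi * x)) + Re (exp (of_nat n * (of_real pi * w))))
    \<le> cmod (gauss_train \<beta> (of_real x) + gauss_train \<beta> w)"
proof -
  let ?a = "\<lambda>n::nat. exp (- (real n powr \<beta>) - pi * (real n)\<^sup>2 / 2)"
  let ?t = "\<lambda>n z. exp (of_real (- (real n powr \<beta>) - pi * (real n)\<^sup>2 / 2)) * exp (of_nat n * (of_real pi * z)) :: complex"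
  let ?s = "\<lambda>n. ?a n * (exp (real n * (pi * x)) + Re (exp (of_nat n * (of_real pi * w))))"
  have Re_t: "Re (?t n z) = ?a n * Re (exp (of_nat n * (of_real pi * z)))" for n z
    by (simp only: exp_of_real) simp
  note sm = summable_gauss_train[OF assms(1,2)]
  have "(\<lambda>n. ?t n (of_real x) + ?t n w) sums (gauss_train \<beta> (of_real x) + gauss_train \<beta> w)"
    unfolding gauss_train_def by (intro sums_add summable_sums sm)
  then have "(\<lambda>n. Re (?t n (of_real x) + ?t n w)) sums Re (gauss_train \<beta> (of_real x) + gauss_train \<beta> w)"
    by (rule sums_Re)
  moreover have "Re (?t n (of_real x) + ?t n w) = ?s n" for n
  proof -
    have "exp (of_nat n * (of_real pi * of_real x)) = (of_real (exp (real n * (pi * x))) :: complex)"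
      by (simp add: exp_of_real[symmetric])
    then show ?thesis unfolding plus_complex.sel Re_t by (simp add: distrib_left)
  qed
  ultimately have s: "?s sums Re (gauss_train \<beta> (of_real x) + gauss_train \<beta> w)" by simp
  have nonneg: "0 \<le> ?s n" for n
  proof -
    have "- Re (exp (of_nat n * (of_real pi * w))) \<le> cmod (exp (of_nat n * (of_real pi * w)))"
      using abs_Re_le_cmod[of "exp (of_nat n * (of_real pi * w))"] by linarith
    also have "\<dots> \<le> exp (real n * (pi * x))"
      using \<open>Re w \<le> x\<close> by (simp add: mult_left_mono)
    finally show ?thesis by simp
  qed
  have "sum ?s {n} \<le> suminf ?s"
    using s nonneg by (intro sum_le_suminf) (auto simp: sums_iff)
  also have "\<dots> = Re (gauss_train \<beta> (of_real x) + gauss_train \<beta> w)"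
    using s by (simp add: sums_iff)
  also have "\<dots> \<le> cmod (gauss_train \<beta> (of_real x) + gauss_train \<beta> w)"
    by (rule complex_Re_le_cmod)
  finally show ?thesis by simp
qed

lemma gauss_train_nonzero:
  assumes "1 \<le> \<beta>" "\<beta> \<le> 2"
  shows "gauss_train \<beta> (of_real x) \<noteq> 0"
  using gauss_train_sum_ge_term[OF assms, of "of_real x" x 0] by auto

text \<open>
  The bump at \<open>n = \<lfloor>x\<rfloor>\<close> is at distance at most \<open>1\<close> from \<open>x\<close>.
\<close>

lemma gauss_train_lower_bound:
  assumes "1 \<le> \<beta>" "\<beta> \<le> 2" and "0 \<le> x" "Re w \<le> 0"
  shows "exp (pi * x\<^sup>2 / 2 - x powr \<beta> - pi / 2) / 2 \<le> cmod (gauss_train \<beta> (of_real x) + gauss_train \<beta> w)"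
proof -
  define n where "n = nat \<lfloor>x\<rfloor>"
  have n: "real n \<le> x" "x \<le> real n + 1" unfolding n_def using \<open>0 \<le> x\<close> by linarith+
  have w: "\<bar>Re (exp (of_nat n * (of_real pi * w)))\<bar> \<le> 1"
  proof -
    have "real n * (pi * Re w) \<le> 0" using \<open>Re w \<le> 0\<close> by (simp add: mult_nonneg_nonpos)
    then show ?thesis
      using abs_Re_le_cmod[of "exp (of_nat n * (of_real pi * w))"] by (simp add: order_trans[OF _ exp_le_one_iff[THEN iffD2]])
  qed
  have half: "exp (real n * (pi * x)) / 2 \<le> exp (real n * (pi * x)) + Re (exp (of_nat n * (of_real pi * w)))"
  proof (cases "n = 0")
    case False
    then have "1 * (1 * 1) \<le> real n * (pi * x)"
      using n pi_gt3 by (intro mult_mono) auto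
    then have "2 \<le> exp (real n * (pi * x))"
      using exp_ge_add_one_self[of "real n * (pi * x)"] by linarith
    then show ?thesis using w by linarith
  qed auto
  have "(x - real n)\<^sup>2 \<le> 1\<^sup>2" using n by (intro power_mono) auto
  then have "pi * (x - real n)\<^sup>2 \<le> pi * 1" by (intro mult_left_mono) auto
  moreover have "real n powr \<beta> \<le> x powr \<beta>" using n assms by (intro powr_mono2) auto
  moreover have "- pi * (real n)\<^sup>2 / 2 + real n * (pi * x) = pi * x\<^sup>2 / 2 - pi * (x - real n)\<^sup>2 / 2"
    by (simp add: power2_eq_square field_simps)
  ultimately have "pi * x\<^sup>2 / 2 - x powr \<beta> - pi / 2
      \<le> - (real n powr \<beta>) - pi * (real n)\<^sup>2 / 2 + real n * (pi * x)" by linarith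
  then have "exp (pi * x\<^sup>2 / 2 - x powr \<beta> - pi / 2) / 2
      \<le> exp (- (real n powr \<beta>) - pi * (real n)\<^sup>2 / 2) * (exp (real n * (pi * x)) / 2)"
    by (simp add: exp_add[symmetric])
  also have "\<dots> \<le> exp (- (real n powr \<beta>) - pi * (real n)\<^sup>2 / 2)
      * (exp (real n * (pi * x)) + Re (exp (of_nat n * (of_real pi * w))))"
    using half by (intro mult_left_mono) auto
  also have "\<dots> \<le> cmod (gauss_train \<beta> (of_real x) + gauss_train \<beta> w)"
    using assms by (intro gauss_train_sum_ge_term) auto
  finally show ?thesis .
qed

section \<open>Gaussian bumps along two rays\<close>

definition two_ray_function :: "real \<Rightarrow> real \<Rightarrow> complex \<Rightarrow> complex" where
  "two_ray_function \<beta> \<theta> z = gauss_train \<beta> (cis (- \<theta>) * z) + gauss_train \<beta> (cis \<theta> * z)"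

lemma entire_two_ray_function:
  assumes "1 \<le> \<beta>" "\<beta> \<le> 2"
  shows "entire (two_ray_function \<beta> \<theta>)"
proof -
  have "(gauss_train \<beta> \<circ> (\<lambda>z. c * z)) holomorphic_on UNIV" for c
    using entire_gauss_train[OF assms] unfolding entire_def
    by (intro holomorphic_on_compose_gen[of _ _ _ UNIV] holomorphic_intros) auto
  then show ?thesis
    unfolding entire_def two_ray_function_def[abs_def] o_def by (intro holomorphic_intros)
qed

lemma two_ray_function_bound:
  assumes "1 \<le> \<beta>" "\<beta> \<le> 2"
  obtains C where "0 < C"
    "\<And>z. cmod (two_ray_function \<beta> \<theta> z) \<le> C * exp (pi * (cmod z)\<^sup>2 / 2 - cmod z powr \<beta> / 16)"
proof -
  obtain C where C: "0 < C"
    "\<And>z. cmod (gauss_train \<beta> z) \<le> C * exp (pi * (cmod z)\<^sup>2 / 2 - pi * (Im z)\<^sup>2 / 4 - cmod z powr \<beta> / 16)"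
    using gauss_train_bound[OF assms] by blast
  have le: "cmod (gauss_train \<beta> (cis t * z)) \<le> C * exp (pi * (cmod z)\<^sup>2 / 2 - cmod z powr \<beta> / 16)" for t z
  proof -
    have "cmod (gauss_train \<beta> (cis t * z))
        \<le> C * exp (pi * (cmod z)\<^sup>2 / 2 - pi * (Im (cis t * z))\<^sup>2 / 4 - cmod z powr \<beta> / 16)"
      using C(2)[of "cis t * z"] by (simp add: norm_mult)
    also have "\<dots> \<le> C * exp (pi * (cmod z)\<^sup>2 / 2 - cmod z powr \<beta> / 16)"
      using C(1) by (intro mult_left_mono) auto
    finally show ?thesis .
  qed
  show ?thesis
  proof (rule that[of "2 * C"])
    fix z show "cmod (two_ray_function \<beta> \<theta> z) \<le> 2 * C * exp (pi * (cmod z)\<^sup>2 / 2 - cmod z powr \<beta> / 16)"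
      unfolding two_ray_function_def
      using norm_triangle_mono[OF le[of "- \<theta>" z] le[of \<theta> z]] by simp
  qed (use C in simp)
qed

text \<open>
  With \<open>z = exp (it) u\<close>, the ray of argument \<open>t\<close> is the positive half-axis of \<open>u\<close>.  As \<open>cos 2t < 0\<close>, the
  function \<open>Re (z\<^sup>2)\<close> is negative on this ray, and completing the square bounds it by a multiple of
  the squared distance to the line through the ray.
\<close>

lemma Re_square_le_of_rotation:
  fixes u :: complex
  assumes \<kappa>: "cos (2 * t) = - \<kappa>" "0 < \<kappa>"
  shows "\<kappa> * Re ((cis t * u)\<^sup>2) \<le> (Im u)\<^sup>2"
proof -
  define s where "s = sin (2 * t)"
  have sq: "s\<^sup>2 = 1 - \<kappa>\<^sup>2"
    using sin_cos_squared_add[of "2 * t"] \<kappa>(1) by (simp add: s_def)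
  have "Re ((cis t * u)\<^sup>2) = Re (cis (2 * t) * u\<^sup>2)"
    by (simp add: power_mult_distrib Complex.DeMoivre)
  also have "\<dots> = - \<kappa> * ((Re u)\<^sup>2 - (Im u)\<^sup>2) - s * (2 * Re u * Im u)"
    using \<kappa>(1) by (simp add: s_def power2_eq_square algebra_simps)
  finally have eq: "Re ((cis t * u)\<^sup>2) = - \<kappa> * ((Re u)\<^sup>2 - (Im u)\<^sup>2) - s * (2 * Re u * Im u)" .
  have "\<kappa> * Re ((cis t * u)\<^sup>2)
      = (\<kappa>\<^sup>2 + s\<^sup>2) * (Im u)\<^sup>2 - (\<kappa> * Re u + s * Im u)\<^sup>2"
    unfolding eq by (simp add: power2_eq_square algebra_simps)
  also have "\<dots> \<le> (Im u)\<^sup>2" by (simp add: sq)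
  finally show ?thesis .
qed

text \<open>
  The coefficient \<open>- cos (2\<theta>) \<pi>/4\<close> is the one for which \<open>Re_square_le_of_rotation\<close> bounds the modulus of the
  exponential by \<open>exp (\<pi> (Im u)\<^sup>2/4)\<close> in the rotated variable \<open>u\<close> of either ray, exactly the decay kept in
  reserve in \<open>gauss_train_bound\<close>.
\<close>

lemma exp_square_times_two_ray_bound:
  assumes \<beta>: "1 \<le> \<beta>" "\<beta> \<le> 2" and \<theta>: "cos (2 * \<theta>) < 0"
  obtains C where "0 < C"
    "\<And>z. cmod (exp (of_real (- cos (2 * \<theta>) * pi / 4) * z\<^sup>2) * two_ray_function \<beta> \<theta> z)
      \<le> C * exp (pi * (cmod z)\<^sup>2 / 2 - cmod z powr \<beta> / 16)"
proof -
  obtain C where C: "0 < C"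
    "\<And>z. cmod (gauss_train \<beta> z) \<le> C * exp (pi * (cmod z)\<^sup>2 / 2 - pi * (Im z)\<^sup>2 / 4 - cmod z powr \<beta> / 16)"
    using gauss_train_bound[OF \<beta>] by blast
  define \<kappa> where "\<kappa> = - cos (2 * \<theta>)"
  let ?G = "\<lambda>z. exp (of_real (\<kappa> * pi / 4) * z\<^sup>2)"
  have le: "cmod (?G z * gauss_train \<beta> (cis t * z)) \<le> C * exp (pi * (cmod z)\<^sup>2 / 2 - cmod z powr \<beta> / 16)"
    if t: "t = \<theta> \<or> t = - \<theta>" for t z
  proof -
    have "\<kappa> * Re ((cis (- t) * (cis t * z))\<^sup>2) \<le> (Im (cis t * z))\<^sup>2"
      by (rule Re_square_le_of_rotation) (use t \<theta> in \<open>auto simp: \<kappa>_def\<close>)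
    moreover have "cis (- t) * (cis t * z) = z" by (simp add: mult.assoc[symmetric] cis_mult)
    ultimately have "\<kappa> * Re (z\<^sup>2) \<le> (Im (cis t * z))\<^sup>2" by simp
    then have "pi / 4 * (\<kappa> * Re (z\<^sup>2)) \<le> pi / 4 * (Im (cis t * z))\<^sup>2"
      by (intro mult_left_mono) auto
    then have "cmod (?G z) \<le> exp (pi * (Im (cis t * z))\<^sup>2 / 4)" 
      by (simp add: mult_ac)
    then have "cmod (?G z * gauss_train \<beta> (cis t * z)) \<le> exp (pi * (Im (cis t * z))\<^sup>2 / 4)
        * (C * exp (pi * (cmod z)\<^sup>2 / 2 - pi * (Im (cis t * z))\<^sup>2 / 4 - cmod z powr \<beta> / 16))"
      unfolding norm_mult using C(2)[of "cis t * z"] by (intro mult_mono) (auto simp: norm_mult)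
    also have "\<dots> = C * exp (pi * (cmod z)\<^sup>2 / 2 - cmod z powr \<beta> / 16)"
      by (simp add: mult.left_commute[of _ C] flip: exp_add)
    finally show ?thesis .
  qed
  show ?thesis
  proof (rule that[of "2 * C"])
    fix z
    have "cmod (?G z * gauss_train \<beta> (cis (- \<theta>) * z) + ?G z * gauss_train \<beta> (cis \<theta> * z))
        \<le> 2 * C * exp (pi * (cmod z)\<^sup>2 / 2 - cmod z powr \<beta> / 16)"
      using norm_triangle_mono[OF le[of "- \<theta>" z] le[of \<theta> z]] by simp
    then show "cmod (exp (of_real (- cos (2 * \<theta>) * pi / 4) * z\<^sup>2) * two_ray_function \<beta> \<theta> z)
        \<le> 2 * C * exp (pi * (cmod z)\<^sup>2 / 2 - cmod z powr \<beta> / 16)"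
      by (simp only: two_ray_function_def \<kappa>_def distrib_left)
  qed (use C in simp)
qed

text \<open>
  On one ray the bumps of the other ray are evaluated at a point of non-positive real part, because the
  rays enclose the angle \<open>2\<theta>\<close>, whose cosine is negative.
\<close>

lemma two_ray_function_lower_bound:
  assumes \<beta>: "1 \<le> \<beta>" "\<beta> \<le> 2" and \<theta>: "cos (2 * \<theta>) < 0" and r: "0 \<le> r" and t: "t = \<theta> \<or> t = - \<theta>"
  shows "exp (pi * r\<^sup>2 / 2 - r powr \<beta> - pi / 2) / 2 \<le> cmod (two_ray_function \<beta> \<theta> (of_real r * cis t))"
proof -
  let ?w = "cis t * (of_real r * cis t)"
  have cancel: "cis (- s) * (of_real r * cis s) = of_real r" "cis s * (of_real r * cis (- s)) = of_real r" for s
    by (simp_all add: mult.left_commute[of _ "of_real r"] cis_mult)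
  have "two_ray_function \<beta> \<theta> (of_real r * cis t) = gauss_train \<beta> (of_real r) + gauss_train \<beta> ?w"
    using t by (elim disjE) (simp_all only: two_ray_function_def cancel add.commute)
  moreover have w: "?w = of_real r * cis (2 * t)"
    by (simp add: mult.left_commute[of _ "of_real r"] cis_mult)
  have "Re ?w = r * cos (2 * \<theta>)" unfolding w using t by auto
  then have "Re ?w \<le> 0" using r \<theta> by (simp add: mult_nonneg_nonpos)
  ultimately show ?thesis
    using gauss_train_lower_bound[OF \<beta> r, of ?w] by simp
qed

text \<open>
  The series has period \<open>2i\<close>.  At the points \<open>x = 2k / sin \<theta>\<close> the two rotated arguments are
  \<open>x cos \<theta> \<minusplus> 2ki\<close>, so both summands equal the non-zero value at \<open>x cos \<theta>\<close>.
\<close>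

lemma two_ray_function_nonzero:
  assumes \<beta>: "1 \<le> \<beta>" "\<beta> \<le> 2" and \<theta>: "sin \<theta> \<noteq> 0"
  shows "two_ray_function \<beta> \<theta> (of_real (2 * real k / sin \<theta>)) \<noteq> 0"
proof -
  let ?x = "2 * real k / sin \<theta>"
  have "cis (- \<theta>) * of_real ?x = of_real (?x * cos \<theta>) + 2 * of_int (- int k) * \<i>"
       "cis \<theta> * of_real ?x = of_real (?x * cos \<theta>) + 2 * of_int (int k) * \<i>"
    using \<theta> by (auto simp: complex_eq_iff)
  then have "two_ray_function \<beta> \<theta> (of_real ?x) = 2 * gauss_train \<beta> (of_real (?x * cos \<theta>))"
    unfolding two_ray_function_def by (simp only: gauss_train_periodic) simp
  then show ?thesis using gauss_train_nonzero[OF \<beta>, of "?x * cos \<theta>"] by (metis mult_eq_0_iff zero_neq_numeral)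
qed


section \<open>Growth and non-approximability\<close>

text \<open>
  Unfolding the limit superior gives the bound for large \<open>\<bar>z\<bar>\<close>; on a disc the entire function is bounded.
\<close>

lemma growth_of_entire_order:
  assumes h: "entire h" "entire_order h \<le> ereal \<alpha>" and a: "\<alpha> < a"
  obtains C where "0 \<le> C" "\<And>z. cmod (h z) \<le> C * exp (cmod z powr a)"
proof -
  have cont: "continuous_on A h" for A
    using h(1) holomorphic_on_imp_continuous_on continuous_on_subset unfolding entire_def by blast
  have "entire_order h < ereal a"
    using h(2) a by (meson ereal_less_eq(3) le_less_trans less_ereal.simps(1))
  then have "eventually (\<lambda>r. ereal (ln_plus (ln_plus (max_modulus h r)) / ln r) < ereal a) at_top"
    unfolding entire_order_def by (rule Limsup_lessD)
  then have "eventually (\<lambda>r::real. max_modulus h r \<le> exp (r powr a)) at_top"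
    using eventually_gt_at_top[of 1]
  proof eventually_elim
    case (elim r)
    define m where "m = ln_plus (max_modulus h r)"
    have "ln m \<le> ln_plus m" if "0 < m"
      using that by (simp add: ln_plus_def)
    moreover have "ln_plus m < a * ln r"
      using elim by (simp add: m_def divide_simps split: if_splits)
    ultimately have "m \<le> r powr a"
      using elim ln_ge_iff[of m "a * ln r"]
      by (cases "0 < m") (auto simp: powr_def not_less intro: order_trans[OF _ exp_ge_zero] 
          simp flip: ln_le_cancel_iff[of m "exp _"])
    moreover have "max_modulus h r \<le> exp m"
      by (simp add: m_def ln_plus_def exp_ln_iff[THEN iffD2] max_def)
    ultimately show ?case by (meson exp_le_cancel_iff order_trans)
  qed
  then obtain R where R: "\<And>r. R \<le> r \<Longrightarrow> max_modulus h r \<le> exp (r powr a)"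
    by (auto simp: eventually_at_top_linorder)
  have "bounded (h ` cball 0 R)"
    by (intro compact_imp_bounded compact_continuous_image cont compact_cball)
  then obtain B where B: "0 < B" "\<And>z. cmod z \<le> R \<Longrightarrow> cmod (h z) \<le> B"
    by (auto simp: bounded_pos)
  have "cmod (h z) \<le> (B + 1) * exp (cmod z powr a)" for z
  proof (cases "cmod z \<le> R")
    case True
    then have "cmod (h z) \<le> (B + 1) * 1" using B(2)[of z] by simp
    also have "\<dots> \<le> (B + 1) * exp (cmod z powr a)"
      using B by (intro mult_left_mono) auto
    finally show ?thesis .
  next
    case False
    have "cmod (h z) \<le> max_modulus h (cmod z)"
      unfolding max_modulus_def
      by (intro cSUP_upper bounded_imp_bdd_above compact_imp_bounded compact_continuous_image
          continuous_intros cont compact_sphere) auto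
    also have "\<dots> \<le> 1 * exp (cmod z powr a)" using R False by simp
    also have "\<dots> \<le> (B + 1) * exp (cmod z powr a)"
      using B by (intro mult_right_mono) auto
    finally show ?thesis .
  qed
  then show ?thesis using that[of "B + 1"] B by auto
qed


text \<open>
  If \<open>p F\<close> approximates \<open>G F\<close>, then \<open>p\<close> is bounded by \<open>2 exp (r\<^sup>\<beta>)\<close> on the two rays, hence by
  \<open>2 K exp (x\<^sup>b)\<close> on the half-axis.  In the limit the same holds for \<open>G(x) = exp (c x\<^sup>2)\<close> at the points of the
  half-axis where \<open>F\<close> does not vanish, and such points occur arbitrarily far out.
\<close>

lemma exp_square_not_in_closed_span:
  assumes \<beta>: "1 \<le> \<beta>" "\<beta> < b" "b < 2" and \<theta>: "cos (2 * \<theta>) < 0" "0 < \<theta>" "b * \<theta> < pi / 2" and c: "0 < c"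
  shows "(\<lambda>z. exp (of_real c * z\<^sup>2) * two_ray_function \<beta> \<theta> z)
    \<notin> closed_span {(\<lambda>z. poly p z * two_ray_function \<beta> \<theta> z) | p :: complex poly. True}"
proof
  let ?F = "two_ray_function \<beta> \<theta>"
  let ?G = "\<lambda>z. exp (of_real c * z\<^sup>2) :: complex"
  assume mem: "(\<lambda>z. ?G z * ?F z) \<in> closed_span {(\<lambda>z. poly p z * ?F z) | p :: complex poly. True}"
  have \<beta>': "1 \<le> \<beta>" "\<beta> \<le> 2" using \<beta> by auto
  define A where "A = sqrt (pi * exp (8 * pi))"
  \<comment> \<open>\<open>A\<close> is the constant of the point evaluations, \<open>c0\<close> that of the lower bound for \<open>F\<close> on the rays.\<close>
  define c0 where "c0 = exp (- pi / 2) / 2"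
  have A: "0 < A" and c0: "0 < c0" by (auto simp: A_def c0_def)
  have approx: "\<exists>p. \<forall>z. cmod (?G z - poly p z) * cmod (?F z) \<le> \<epsilon> * exp (pi * (cmod z)\<^sup>2 / 2)" if "0 < \<epsilon>" for \<epsilon>
  proof -
    have "0 < \<epsilon> / A" using that A by simp
    then obtain g where g: "g \<in> complex_span {(\<lambda>z. poly p z * ?F z) | p :: complex poly. True}"
        "g \<in> fock_space" "fock_norm (\<lambda>z. ?G z * ?F z - g z) < \<epsilon> / A"
      using closed_spanD(2)[OF mem] by blast
    then obtain p where p: "g = (\<lambda>z. poly p z * ?F z)"
      unfolding complex_span_polynomial_multiples by blast
    have "cmod (?G z - poly p z) * cmod (?F z) \<le> \<epsilon> * exp (pi * (cmod z)\<^sup>2 / 2)" for z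
    proof -
      have "cmod (?G z - poly p z) * cmod (?F z) = cmod (?G z * ?F z - g z)"
        by (simp add: p norm_mult[symmetric] left_diff_distrib)
      also have "\<dots> \<le> A * fock_norm (\<lambda>z. ?G z * ?F z - g z) * exp (pi * (cmod z)\<^sup>2 / 2)"
        unfolding A_def by (intro fock_pointwise_bound fock_space_diff closed_spanD(1)[OF mem] g)
      also have "\<dots> \<le> A * (\<epsilon> / A) * exp (pi * (cmod z)\<^sup>2 / 2)"
        using g(3) A by (intro mult_right_mono mult_left_mono) auto
      finally show ?thesis using A by simp
    qed
    then show ?thesis by blast
  qed
  have "0 < \<beta>" using \<beta> by simp
  obtain K where K: "0 < K"
    "\<And>p D x. \<lbrakk>0 < D; \<And>r t. \<lbrakk>0 \<le> r; t = \<theta> \<or> t = - \<theta>\<rbrakk> \<Longrightarrow> cmod (poly p (of_real r * cis t)) \<le> D * exp (r powr \<beta>);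
       0 < x\<rbrakk> \<Longrightarrow> cmod (poly p (of_real x)) \<le> K * D * exp (x powr b)"
    using poly_bound_on_axis_of_rays[OF \<open>0 < \<beta>\<close> \<beta>(2) \<theta>(2,3)] by metis
  have rays: "cmod (poly p (of_real r * cis t)) \<le> 2 * exp (r powr \<beta>)"
    if p: "\<And>z. cmod (?G z - poly p z) * cmod (?F z) \<le> \<epsilon> * exp (pi * (cmod z)\<^sup>2 / 2)"
      and \<epsilon>: "0 < \<epsilon>" "\<epsilon> \<le> c0" and rt: "0 \<le> r" "t = \<theta> \<or> t = - \<theta>" for p \<epsilon> r t
  proof -
    let ?z = "of_real r * cis t"
    have "Re (?z\<^sup>2) = r\<^sup>2 * cos (2 * \<theta>)"
      using rt by (auto simp: power_mult_distrib Complex.DeMoivre simp flip: of_real_power)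
    then have "Re (?z\<^sup>2) \<le> 0" using \<theta>(1) by (simp add: mult_nonneg_nonpos)
    then have G: "cmod (?G ?z) \<le> 1"
      using c by (simp add: mult_nonneg_nonpos)
    have E: "c0 * exp (pi * r\<^sup>2 / 2) * exp (- (r powr \<beta>)) \<le> cmod (?F ?z)"
      using two_ray_function_lower_bound[OF \<beta>' \<theta>(1) rt]
      by (simp add: c0_def exp_add[symmetric] algebra_simps)
    have "cmod (?G ?z - poly p ?z) * (c0 * exp (pi * r\<^sup>2 / 2) * exp (- (r powr \<beta>)))
        \<le> cmod (?G ?z - poly p ?z) * cmod (?F ?z)"
      by (intro mult_left_mono E) auto
    also have "\<dots> \<le> \<epsilon> * exp (pi * r\<^sup>2 / 2)"
      using p[of ?z] by (simp add: norm_mult)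
    also have "\<dots> \<le> c0 * exp (pi * r\<^sup>2 / 2)"
      using \<epsilon> by (intro mult_right_mono) auto
    finally have "cmod (?G ?z - poly p ?z) * exp (- (r powr \<beta>)) \<le> 1"
      using c0 by (simp add: mult_ac)
    then have "cmod (?G ?z - poly p ?z) \<le> exp (r powr \<beta>)"
      by (simp add: exp_minus divide_simps)
    moreover have "cmod (poly p ?z) \<le> cmod (?G ?z) + cmod (?G ?z - poly p ?z)"
      using norm_triangle_ineq4[of "?G ?z" "?G ?z - poly p ?z"] by simp
    moreover have "1 \<le> exp (r powr \<beta>)" by simp
    ultimately show ?thesis using G by linarith
  qed
  \<comment> \<open>The approximation at the single point \<open>x\<close>, with error \<open>\<delta>\<close> tending to \<open>0\<close>, transfers
      the bound from the polynomials to \<open>G\<close>.\<close>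
  have key: "exp (c * x\<^sup>2) \<le> 2 * K * exp (x powr b)" if x: "0 < x" "?F (of_real x) \<noteq> 0" for x
  proof -
    let ?m = "cmod (?F (of_real x))" and ?E = "exp (pi * x\<^sup>2 / 2)"
    have m: "0 < ?m" using x by simp
    have "exp (c * x\<^sup>2) \<le> 2 * K * exp (x powr b) + \<delta>" if \<delta>: "0 < \<delta>" for \<delta>
    proof -
      define \<epsilon> where "\<epsilon> = min c0 (\<delta> * ?m / ?E)"
      have \<epsilon>: "0 < \<epsilon>" "\<epsilon> \<le> c0" "\<epsilon> \<le> \<delta> * ?m / ?E" using c0 m \<delta> by (auto simp: \<epsilon>_def)
      obtain p where p: "\<And>z. cmod (?G z - poly p z) * cmod (?F z) \<le> \<epsilon> * exp (pi * (cmod z)\<^sup>2 / 2)"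
        using approx[OF \<epsilon>(1)] by blast
      have "cmod (poly p (of_real x)) \<le> K * 2 * exp (x powr b)"
        using rays[OF p \<epsilon>(1,2)] x by (intro K(2)) auto
      moreover have "cmod (?G (of_real x) - poly p (of_real x)) \<le> \<delta>"
      proof -
        have "cmod (?G (of_real x) - poly p (of_real x)) * ?m \<le> \<epsilon> * ?E"
          using p[of "of_real x"] by simp
        also have "\<dots> \<le> \<delta> * ?m" using \<epsilon>(3) by (simp add: field_simps)
        finally show ?thesis using m by simp
      qed
      moreover have "cmod (?G (of_real x)) \<le> cmod (?G (of_real x) - poly p (of_real x)) + cmod (poly p (of_real x))"
        using norm_triangle_ineq[of "?G (of_real x) - poly p (of_real x)" "poly p (of_real x)"] by simp
      moreover have "cmod (?G (of_real x)) = exp (c * x\<^sup>2)"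
        by (simp flip: of_real_power)
      ultimately show ?thesis by linarith
    qed
    then show ?thesis by (rule field_le_epsilon)
  qed
  have "eventually (\<lambda>x::real. 2 * K * exp (x powr b) < exp (c * x\<^sup>2)) at_top"
    using K(1) \<beta> c by real_asymp
  moreover have "\<theta> < pi / 2"
  proof -
    have "1 * \<theta> \<le> b * \<theta>" using \<beta> \<theta> by (intro mult_right_mono) auto
    then show ?thesis using \<theta> by linarith
  qed
  then have s: "0 < sin \<theta>" using \<theta> by (intro sin_gt_zero2) auto
  then have "filterlim (\<lambda>k. 2 * real k / sin \<theta>) at_top sequentially"
    by real_asymp
  ultimately have "eventually (\<lambda>k. 2 * K * exp ((2 * real k / sin \<theta>) powr b) < exp (c * (2 * real k / sin \<theta>)\<^sup>2)) sequentially"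
    by (rule eventually_compose_filterlim)
  from eventually_happens[OF eventually_conj[OF this eventually_gt_at_top[of 0]]]
  obtain k where k: "2 * K * exp ((2 * real k / sin \<theta>) powr b) < exp (c * (2 * real k / sin \<theta>)\<^sup>2)" "0 < k"
    by auto
  then show False
    using key[of "2 * real k / sin \<theta>"] two_ray_function_nonzero[OF \<beta>', of \<theta> k] s by auto
qed


theorem theorem1p2:
  fixes \<alpha> :: real
  assumes "1 < \<alpha>" and "\<alpha> < 2"
  shows "\<exists>F G. entire F \<and> entire G
    \<and> G \<in> fock_space \<and> (\<lambda>z. G z * F z) \<in> fock_space
    \<and> (\<forall>h. entire h \<and> entire_order h \<le> ereal \<alpha> \<longrightarrow> (\<lambda>z. h z * F z) \<in> fock_space)
    \<and> (\<lambda>z. G z * F z) \<notin> closed_span {(\<lambda>z. poly p z * F z) | p :: complex poly. True}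
    \<and> closed_span {(\<lambda>z. poly p z * F z) | p :: complex poly. True}
        = closed_span {(\<lambda>z. exp (l * z) * F z) | l :: complex. True}"
proof -
  obtain \<beta> where \<beta>: "\<alpha> < \<beta>" "\<beta> < 2" using dense[OF assms(2)] by blast
  obtain b where b: "\<beta> < b" "b < 2" using dense[OF \<beta>(2)] by blast
  \<comment> \<open>The intermediate exponent \<open>a\<close> leaves room between the order of \<open>h\<close> and the decay of \<open>F\<close>.\<close>
  obtain a where a: "\<alpha> < a" "a < \<beta>" using dense[OF \<beta>(1)] by blast
  have "pi / 4 < pi / (2 * b)" using b \<beta> assms by (simp add: field_simps)
  then obtain \<theta> where \<theta>: "pi / 4 < \<theta>" "\<theta> < pi / (2 * b)" using dense by blast
  have b\<theta>: "b * \<theta> < pi / 2" using \<theta>(2) b \<beta> assms by (simp add: field_simps)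
  have "0 < \<theta>" using \<theta>(1) pi_gt_zero by linarith
  have "1 * \<theta> \<le> b * \<theta>" using b \<beta> assms \<open>0 < \<theta>\<close> by (intro mult_right_mono) auto
  then have "\<theta> < pi / 2" using b\<theta> by linarith
  have cos2: "cos (2 * \<theta>) < 0"
    using \<theta>(1) \<open>\<theta> < pi / 2\<close> cos_monotone_0_pi[of "pi / 2" "2 * \<theta>"] by simp
  have \<beta>': "1 \<le> \<beta>" "\<beta> \<le> 2" using \<beta> assms by auto
  define F where "F = two_ray_function \<beta> \<theta>"
  define c where "c = - cos (2 * \<theta>) * pi / 4"
  define G where "G = (\<lambda>z. exp (of_real c * z\<^sup>2) :: complex)"
  have c: "0 < c" "c \<le> pi / 4"
  proof -
    show "0 < c" using cos2 by (simp add: c_def mult_neg_pos)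
    have "- cos (2 * \<theta>) * (pi / 4) \<le> 1 * (pi / 4)"
      using cos_ge_minus_one[of "2 * \<theta>"] by (intro mult_right_mono) auto
    then show "c \<le> pi / 4" by (simp add: c_def)
  qed
  have F: "entire F" unfolding F_def by (rule entire_two_ray_function[OF \<beta>'])
  have G: "entire G" unfolding G_def entire_def by (intro holomorphic_intros)
  obtain C where C: "0 < C" "\<And>z. cmod (F z) \<le> C * exp (pi * (cmod z)\<^sup>2 / 2 - cmod z powr \<beta> / 16)"
    unfolding F_def using two_ray_function_bound[OF \<beta>'] by blast
  have decay: "\<exists>B. \<forall>s\<ge>0. s powr e + s - s powr \<beta> / 16 \<le> B" if e: "0 < e" "e < \<beta>" for e
  proof -
    obtain B1 where B1: "\<And>s. 0 \<le> s \<Longrightarrow> s powr e \<le> 1 / 32 * s powr \<beta> + B1"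
      using powr_le_powr_plus[of e \<beta> "1 / 32"] e by auto
    obtain B2 where B2: "\<And>s. 0 \<le> s \<Longrightarrow> s powr 1 \<le> 1 / 32 * s powr \<beta> + B2"
      using powr_le_powr_plus[of 1 \<beta> "1 / 32"] \<beta> assms by auto
    have "s powr e + s - s powr \<beta> / 16 \<le> B1 + B2" if "0 \<le> s" for s
      using B1[OF that] B2[OF that] that by simp
    then show ?thesis by blast
  qed
  have mult_fock: "(\<lambda>z. h z * F z) \<in> fock_space"
    if h: "entire h" "0 \<le> D" "\<And>z. cmod (h z) \<le> D * exp (cmod z powr e)" "0 < e" "e < \<beta>" for h D e
  proof -
    obtain B where B: "\<And>s. 0 \<le> s \<Longrightarrow> s powr e + s - s powr \<beta> / 16 \<le> B"
      using decay[OF h(4,5)] by blast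
    show ?thesis
    proof (rule fock_spaceI_bound[of _ 1 "D * C * exp B"])
      show "entire (\<lambda>z. h z * F z)" using h(1) F by (auto simp: entire_def intro: holomorphic_intros)
      fix z
      have "cmod (h z * F z) \<le> D * exp (cmod z powr e) * (C * exp (pi * (cmod z)\<^sup>2 / 2 - cmod z powr \<beta> / 16))"
        unfolding norm_mult using h C by (intro mult_mono) auto
      also have "\<dots> = D * C * exp (cmod z powr e + (pi * (cmod z)\<^sup>2 / 2 - cmod z powr \<beta> / 16))"
        by (simp only: exp_add mult_ac)
      also have "\<dots> \<le> D * C * exp (B + (pi * (cmod z)\<^sup>2 / 2 - 1 * cmod z))"
        using B[of "cmod z"] C(1) h(2) by (intro mult_left_mono) auto
      also have "\<dots> = D * C * exp B * exp (pi * (cmod z)\<^sup>2 / 2 - 1 * cmod z)"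
        by (simp only: exp_add mult_ac)
      finally show "cmod (h z * F z) \<le> D * C * exp B * exp (pi * (cmod z)\<^sup>2 / 2 - 1 * cmod z)" .
    qed auto
  qed
  have "G \<in> fock_space"
  proof (rule fock_spaceI_bound[OF G, of 1 "exp 1"])
    fix z
    have "0 \<le> (cmod z - 2)\<^sup>2" by simp
    then have "4 * cmod z \<le> (cmod z)\<^sup>2 + 4" by (simp add: power2_eq_square algebra_simps)
    moreover have "1 * (cmod z)\<^sup>2 \<le> pi * (cmod z)\<^sup>2" using pi_gt3 by (intro mult_right_mono) auto
    moreover have "c * Re (z\<^sup>2) \<le> pi / 4 * (cmod z)\<^sup>2"
      using c complex_Re_le_cmod[of "z\<^sup>2"] order_trans[OF mult_left_mono[of "Re (z\<^sup>2)" "(cmod z)\<^sup>2" c] mult_right_mono[of c "pi / 4" "(cmod z)\<^sup>2"]]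
      by (simp add: norm_power)
    ultimately have "c * Re (z\<^sup>2) \<le> 1 + (pi * (cmod z)\<^sup>2 / 2 - 1 * cmod z)" by linarith
    then show "cmod (G z) \<le> exp 1 * exp (pi * (cmod z)\<^sup>2 / 2 - 1 * cmod z)"
      unfolding exp_add[symmetric] G_def norm_exp_eq_Re by (simp del: power2_eq_square)
  qed simp
  moreover have "(\<lambda>z. G z * F z) \<in> fock_space"
  proof -
    obtain C' where C': "0 < C'" "\<And>z. cmod (G z * F z) \<le> C' * exp (pi * (cmod z)\<^sup>2 / 2 - cmod z powr \<beta> / 16)"
      unfolding F_def G_def c_def using exp_square_times_two_ray_bound[OF \<beta>' cos2] by blast
    obtain B where B: "\<And>s. 0 \<le> s \<Longrightarrow> s powr a + s - s powr \<beta> / 16 \<le> B"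
      using decay[of a] a assms by auto
    show ?thesis
    proof (rule fock_spaceI_bound[of _ 1 "C' * exp B"])
      show "entire (\<lambda>z. G z * F z)" using G F by (auto simp: entire_def intro: holomorphic_intros)
      fix z
      have "- (cmod z powr \<beta> / 16) \<le> B - cmod z"
        using B[of "cmod z"] powr_ge_zero[of "cmod z" a] norm_ge_zero[of z] by linarith
      then have "C' * exp (pi * (cmod z)\<^sup>2 / 2 - cmod z powr \<beta> / 16)
          \<le> C' * exp (B + (pi * (cmod z)\<^sup>2 / 2 - 1 * cmod z))"
        using C'(1) by (intro mult_left_mono) auto
      with C'(2)[of z] show "cmod (G z * F z) \<le> C' * exp B * exp (pi * (cmod z)\<^sup>2 / 2 - 1 * cmod z)"
        by (simp add: exp_add)
    qed auto
  qed
  moreover have "(\<lambda>z. h z * F z) \<in> fock_space" if h: "entire h" "entire_order h \<le> ereal \<alpha>" for h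
  proof -
    obtain D where "0 \<le> D" "\<And>z. cmod (h z) \<le> D * exp (cmod z powr a)"
      using growth_of_entire_order[OF h a(1)] by blast
    then show ?thesis using h(1) a assms by (intro mult_fock[of h D a]) auto
  qed
  moreover have "(\<lambda>z. G z * F z) \<notin> closed_span {(\<lambda>z. poly p z * F z) | p :: complex poly. True}"
    unfolding F_def G_def
    using \<beta>' b cos2 \<open>0 < \<theta>\<close> b\<theta> c(1) by (intro exp_square_not_in_closed_span[of \<beta> b]) auto
  moreover have "closed_span {(\<lambda>z. poly p z * F z) | p :: complex poly. True}
        = closed_span {(\<lambda>z. exp (l * z) * F z) | l :: complex. True}"
  proof (rule closed_span_polynomials_eq_exps[OF F])
    fix k :: real
    obtain B where B: "\<And>s. 0 \<le> s \<Longrightarrow> s powr 1 \<le> 1 / (16 * (\<bar>k\<bar> + 1)) * s powr \<beta> + B"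
      by (rule powr_le_powr_plus[of 1 \<beta> "1 / (16 * (\<bar>k\<bar> + 1))"]) (use \<beta> assms in \<open>auto simp: add_nonneg_pos\<close>)
    have "cmod (F z) \<le> C * exp ((\<bar>k\<bar> + 1) * B) * exp (pi * (cmod z)\<^sup>2 / 2 - k * cmod z)" for z
    proof -
      have "k * cmod z \<le> (\<bar>k\<bar> + 1) * cmod z" by (intro mult_right_mono) auto
      also have "\<dots> \<le> (\<bar>k\<bar> + 1) * (1 / (16 * (\<bar>k\<bar> + 1)) * cmod z powr \<beta> + B)"
        using B[of "cmod z"] by (intro mult_left_mono) auto
      also have "\<dots> = cmod z powr \<beta> / 16 + (\<bar>k\<bar> + 1) * B"
        by (simp add: field_simps)
      finally have "C * exp (pi * (cmod z)\<^sup>2 / 2 - cmod z powr \<beta> / 16)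
          \<le> C * exp ((\<bar>k\<bar> + 1) * B + (pi * (cmod z)\<^sup>2 / 2 - k * cmod z))"
        using C(1) by (intro mult_left_mono) auto
      with C(2)[of z] show ?thesis by (simp only: exp_add mult_ac)
    qed
    then show "\<exists>C. \<forall>z. cmod (F z) \<le> C * exp (pi * (cmod z)\<^sup>2 / 2 - k * cmod z)" by blast
  qed
  ultimately show ?thesis using F G by blast
qed

end
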